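(* Let $H$ and $K$ be nonzero complex Hilbert spaces, let $n$ be a positive integer, let $T_1\in B(H)$ and $T_2\in B(K)$, and suppose that both $T_1$ and $T_2$ are left invertible. Then the following are equivalent: (a) $T_1\otimes T_2$ is an $n$-symmetry in $B(H\overline\otimes K)$. (b) There exist positive integers $l,m$ with $l+m=n+1$ and $\lambda\in\mathbb{C}$ with $|\lambda|=1$ such that $\lambda T_1$ is an $l$-symmetry in $B(H)$ and $\bar\lambda T_2$ is an $m$-symmetry in $B(K)$.
   Context: $B(H)$ is the algebra of bounded linear operators on $H$, and $H\overline\otimes K$ is the Hilbert space tensor product. For $S,T$ in a unital $\mathbb{C}$-algebra define $\gamma_n(S,T)=\sum_{k=0}^n(-1)^{n-k}\binom{n}{k}S^kT^{n-k}$. An operator $T$ on a Hilbert space is an $n$-symmetry if $\gamma_n(T^\ast,T)=0$. $T$ is left invertible if there is a bounded operator $L$ with $LT=I$. *)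

theory Defs
  imports "HOL-Analysis.Analysis" "HOL-Library.Poly_Mapping"
begin

class complex_vector = ab_group_add +
  fixes scaleC :: "complex \<Rightarrow> 'a \<Rightarrow> 'a"  (infixr \<open>*\<^sub>C\<close> 75)
  assumes scaleC_add_right: "c *\<^sub>C (x + y) = c *\<^sub>C x + c *\<^sub>C y"
    and scaleC_add_left: "(c + d) *\<^sub>C x = c *\<^sub>C x + d *\<^sub>C x"
    and scaleC_scaleC [simp]: "c *\<^sub>C (d *\<^sub>C x) = (c * d) *\<^sub>C x"
    and scaleC_one [simp]: "1 *\<^sub>C x = x"

global_interpretation complex_vector: vector_space "scaleC :: complex \<Rightarrow> 'a \<Rightarrow> 'a::complex_vector"
  by unfold_locales (simp_all add: scaleC_add_right scaleC_add_left)

abbreviation clinear :: "('a::complex_vector \<Rightarrow> 'b::complex_vector) \<Rightarrow> bool"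
  where "clinear \<equiv> Vector_Spaces.linear scaleC scaleC"

lemma clinear_iff:
  "clinear f \<longleftrightarrow> (\<forall>x y. f (x + y) = f x + f y) \<and> (\<forall>c x. f (c *\<^sub>C x) = c *\<^sub>C f x)"
  by (simp add: Vector_Spaces.linear_iff complex_vector.vector_space_axioms)

lemma clinear_add: "clinear f \<Longrightarrow> f (x + y) = f x + f y"
  and clinear_scaleC: "clinear f \<Longrightarrow> f (c *\<^sub>C x) = c *\<^sub>C f x"
  by (simp_all add: clinear_iff)

lemma clinear_zero: "clinear f \<Longrightarrow> f 0 = 0"
  using clinear_add[of f 0 0] by simp

lemma clinear_diff: "clinear f \<Longrightarrow> f (x - y) = f x - f y"
  using clinear_add[of f "x - y" y] by (simp add: algebra_simps)

lemma clinear_sum: "clinear f \<Longrightarrow> f (\<Sum>i\<in>A. g i) = (\<Sum>i\<in>A. f (g i))"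
  by (induction A rule: infinite_finite_induct) (simp_all add: clinear_zero clinear_add)

instantiation complex :: complex_vector
begin
definition scaleC_complex :: "complex \<Rightarrow> complex \<Rightarrow> complex"
  where scaleC_complex_def [simp]: "scaleC_complex c x = c * x"
instance by standard (simp_all add: algebra_simps)
end

text \<open>Unital complex algebras. \<open>0 \<noteq> 1\<close> is not required, so that the operators on an
  arbitrary (possibly zero) space are an instance.\<close>

class complex_algebra_1 = complex_vector + ring + monoid_mult +
  assumes mult_scaleC_left: "(c *\<^sub>C x) * y = c *\<^sub>C (x * y)"
    and mult_scaleC_right: "x * (c *\<^sub>C y) = c *\<^sub>C (x * y)"

text \<open>The inner product is linear in the first argument. The real vector space and norm
  structure of \<open>real_normed_vector\<close> is tied to it by \<open>scaleR_scaleC\<close> and \<open>cinner_self\<close>.\<close>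

class complex_inner = complex_vector + real_normed_vector +
  fixes cinner :: "'a \<Rightarrow> 'a \<Rightarrow> complex"
  assumes scaleR_scaleC: "r *\<^sub>R x = complex_of_real r *\<^sub>C x"
    and cinner_commute: "cinner x y = cnj (cinner y x)"
    and cinner_add_left: "cinner (x + y) z = cinner x z + cinner y z"
    and cinner_scaleC_left: "cinner (c *\<^sub>C x) y = c * cinner x y"
    and cinner_self: "cinner x x = complex_of_real ((norm x)\<^sup>2)"

class chilbert_space = complex_inner + complete_space

lemma cinner_add_right: "cinner x (y + z) = cinner x y + cinner x z"
  by (metis cinner_add_left cinner_commute complex_cnj_add)

lemma cinner_scaleC_right: "cinner x (c *\<^sub>C y) = cnj c * cinner x y"
  by (metis cinner_scaleC_left cinner_commute complex_cnj_mult)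

lemma cinner_zero_left [simp]: "cinner 0 x = 0"
  using cinner_add_left[of 0 0 x] by simp

lemma cinner_zero_right [simp]: "cinner x 0 = 0"
  using cinner_add_right[of x 0 0] by simp

lemma cinner_diff_left: "cinner (x - y) z = cinner x z - cinner y z"
  using cinner_add_left[of "x - y" y z] by (simp add: algebra_simps)

lemma cinner_diff_right: "cinner x (y - z) = cinner x y - cinner x z"
  using cinner_add_right[of x "y - z" z] by (simp add: algebra_simps)

lemma cinner_sum_left: "cinner (\<Sum>i\<in>A. f i) y = (\<Sum>i\<in>A. cinner (f i) y)"
  by (induction A rule: infinite_finite_induct) (simp_all add: cinner_add_left)

lemma cinner_sum_right: "cinner y (\<Sum>i\<in>A. f i) = (\<Sum>i\<in>A. cinner y (f i))"
  by (induction A rule: infinite_finite_induct) (simp_all add: cinner_add_right)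

lemma cinner_self_eq_0 [simp]: "cinner x x = 0 \<longleftrightarrow> x = 0"
  by (simp add: cinner_self)

lemma norm_scaleC: "norm (c *\<^sub>C x) = cmod c * norm (x::'a::complex_inner)"
proof -
  have "complex_of_real ((norm (c *\<^sub>C x))\<^sup>2) = complex_of_real ((cmod c * norm x)\<^sup>2)"
    unfolding cinner_self[symmetric] cinner_scaleC_left cinner_scaleC_right
    using complex_norm_square[of c] by (simp add: cinner_self power_mult_distrib mult_ac)
  hence "(norm (c *\<^sub>C x))\<^sup>2 = (cmod c * norm x)\<^sup>2"
    by (simp only: of_real_eq_iff)
  thus ?thesis by simp
qed

lemma norm_add_square: "(norm (x + y))\<^sup>2 = (norm (x::'a::complex_inner))\<^sup>2 + (norm y)\<^sup>2 + 2 * Re (cinner x y)"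
proof -
  have "complex_of_real ((norm (x + y))\<^sup>2) = cinner x x + cinner y y + (cinner x y + cnj (cinner x y))"
    unfolding cinner_self[symmetric] cinner_add_left cinner_add_right
    using cinner_commute[of y x] by simp
  hence "Re (complex_of_real ((norm (x + y))\<^sup>2)) = Re (cinner x x + cinner y y + (cinner x y + cnj (cinner x y)))"
    by simp
  thus ?thesis unfolding cinner_self by simp
qed

lemma cauchy_schwarz: "cmod (cinner x y) \<le> norm x * norm (y::'a::complex_inner)"
proof (cases "y = 0")
  case False
  define c where "c = cinner x y / cinner y y"
  have ny: "norm y > 0" using False by simp
  have c: "cinner x y = c * (norm y)\<^sup>2" using False by (simp add: c_def cinner_self)
  have "cinner (x - c *\<^sub>C y) (x - c *\<^sub>C y)
      = cinner x x - cnj c * cinner x y - c * cnj (cinner x y) + c * cnj c * cinner y y"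
    by (simp add: cinner_diff_left cinner_diff_right cinner_scaleC_left cinner_scaleC_right
        cinner_commute[of y x] algebra_simps)
  also have "\<dots> = cinner x x - c * cnj c * (norm y)\<^sup>2"
    by (simp add: c cinner_self[of y])
  also have "\<dots> = complex_of_real ((norm x)\<^sup>2 - (cmod c * norm y)\<^sup>2)"
    using complex_norm_square[of c] by (simp add: cinner_self power_mult_distrib mult_ac)
  finally have "(norm (x - c *\<^sub>C y))\<^sup>2 = (norm x)\<^sup>2 - (cmod c * norm y)\<^sup>2"
    unfolding cinner_self by (simp only: of_real_eq_iff)
  hence "(cmod c * norm y)\<^sup>2 \<le> (norm x)\<^sup>2"
    by (metis diff_ge_0_iff_ge zero_le_power2)
  hence "cmod c * norm y \<le> norm x" by (rule power2_le_imp_le) simp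
  hence "cmod c * norm y * norm y \<le> norm x * norm y"
    by (rule mult_right_mono) simp
  thus ?thesis by (simp add: c norm_mult norm_power power2_eq_square mult.assoc)
qed simp

lemma cinner_ext: "(\<And>y. cinner x y = cinner x' y) \<Longrightarrow> x = x'"
proof -
  assume "\<And>y. cinner x y = cinner x' y"
  hence "cinner (x - x') (x - x') = 0" by (simp add: cinner_diff_left)
  thus ?thesis by simp
qed

lemma bounded_bilinear_cinner: "bounded_bilinear (cinner :: 'a::complex_inner \<Rightarrow> 'a \<Rightarrow> complex)"
proof
  show "\<exists>K. \<forall>a b::'a. norm (cinner a b) \<le> norm a * norm b * K"
    by (intro exI[of _ 1]) (simp add: cauchy_schwarz)
qed (simp_all add: cinner_add_left cinner_add_right scaleR_scaleC cinner_scaleC_left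
      cinner_scaleC_right scaleR_conv_of_real)

definition bounded_clinear :: "('a::complex_inner \<Rightarrow> 'b::complex_inner) \<Rightarrow> bool"
  where "bounded_clinear f \<longleftrightarrow> clinear f \<and> (\<exists>K. \<forall>x. norm (f x) \<le> norm x * K)"

lemma bounded_clinearI:
  assumes "\<And>x y. f (x + y) = f x + f y" "\<And>c x. f (c *\<^sub>C x) = c *\<^sub>C f x"
    and "\<And>x. norm (f x) \<le> norm x * K"
  shows "bounded_clinear f"
  using assms unfolding bounded_clinear_def clinear_iff by blast

lemma bounded_clinear_bounded_linear: "bounded_clinear f \<Longrightarrow> bounded_linear f"
  unfolding bounded_clinear_def clinear_iff
  by (auto intro: bounded_linear_intro simp: scaleR_scaleC)

lemma bounded_clinear_nonneg:
  assumes "bounded_clinear f"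
  obtains K where "K \<ge> 0" "\<And>x. norm (f x) \<le> norm x * K"
  using bounded_linear.nonneg_bounded[OF bounded_clinear_bounded_linear[OF assms]] by blast

typedef (overloaded) 'a bop = "{f :: 'a::complex_inner \<Rightarrow> 'a. bounded_clinear f}"
  morphisms app_bop Abs_bop
proof
  show "(\<lambda>_. 0) \<in> {f :: 'a \<Rightarrow> 'a. bounded_clinear f}"
    by (auto intro: bounded_clinearI[where K = 0])
qed

setup_lifting type_definition_bop

lemma bop_bounded_clinear: "bounded_clinear (app_bop T)"
  using app_bop by blast

lemma bop_clinear: "clinear (app_bop T)"
  using bop_bounded_clinear[of T] by (simp add: bounded_clinear_def)

lemmas bop_add = clinear_add[OF bop_clinear]
  and bop_scaleC = clinear_scaleC[OF bop_clinear]

lemma bop_eqI: "(\<And>x. app_bop S x = app_bop T x) \<Longrightarrow> S = T"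
  by (simp add: app_bop_inject[symmetric] fun_eq_iff)

instantiation bop :: (complex_inner) complex_algebra_1
begin

lift_definition zero_bop :: "'a bop" is "\<lambda>_. 0"
  by (rule bounded_clinearI[where K = 0]) simp_all

lift_definition one_bop :: "'a bop" is "\<lambda>x. x"
  by (rule bounded_clinearI[where K = 1]) simp_all

lift_definition plus_bop :: "'a bop \<Rightarrow> 'a bop \<Rightarrow> 'a bop" is "\<lambda>S T x. S x + T x"
proof -
  fix S T :: "'a \<Rightarrow> 'a" assume "bounded_clinear S" "bounded_clinear T"
  moreover from this obtain K L where
    "\<And>x. norm (S x) \<le> norm x * K" "\<And>x. norm (T x) \<le> norm x * L"
    by (auto simp: bounded_clinear_def)
  ultimately show "bounded_clinear (\<lambda>x. S x + T x)"
    by (intro bounded_clinearI[where K = "K + L"])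
       (auto simp: bounded_clinear_def clinear_iff scaleC_add_right distrib_left
         intro: norm_triangle_mono)
qed

lift_definition scaleC_bop :: "complex \<Rightarrow> 'a bop \<Rightarrow> 'a bop" is "\<lambda>c T x. c *\<^sub>C T x"
proof -
  fix c and T :: "'a \<Rightarrow> 'a" assume T: "bounded_clinear T"
  then obtain K where "\<And>x. norm (T x) \<le> norm x * K"
    by (auto simp: bounded_clinear_def)
  hence "cmod c * norm (T x) \<le> cmod c * (norm x * K)" for x
    by (intro mult_left_mono) auto
  with T show "bounded_clinear (\<lambda>x. c *\<^sub>C T x)"
    by (intro bounded_clinearI[where K = "cmod c * K"])
       (auto simp: bounded_clinear_def clinear_iff scaleC_add_right norm_scaleC mult_ac)
qed

definition uminus_bop :: "'a bop \<Rightarrow> 'a bop" where "uminus_bop T = (-1) *\<^sub>C T"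
definition minus_bop :: "'a bop \<Rightarrow> 'a bop \<Rightarrow> 'a bop" where "minus_bop S T = S + - T"

lift_definition times_bop :: "'a bop \<Rightarrow> 'a bop \<Rightarrow> 'a bop" is "\<lambda>S T x. S (T x)"
proof -
  fix S T :: "'a \<Rightarrow> 'a" assume ST: "bounded_clinear S" "bounded_clinear T"
  have "bounded_linear (\<lambda>x. S (T x))"
    by (rule bounded_linear_compose[OF ST[THEN bounded_clinear_bounded_linear]])
  then obtain K where "\<And>x. norm (S (T x)) \<le> norm x * K"
    using bounded_linear.bounded by blast
  with ST show "bounded_clinear (\<lambda>x. S (T x))"
    by (intro bounded_clinearI) (auto simp: bounded_clinear_def clinear_iff)
qed

instance
proof
  fix a b c :: "'a bop" and r s :: complex
  show "a + b + c = a + (b + c)" "a + b = b + a" "0 + a = a"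
    by (transfer, simp add: algebra_simps)+
  show "- a + a = 0"
    unfolding uminus_bop_def
    by transfer (use complex_vector.scale_minus_left[of 1] in \<open>simp add: fun_eq_iff\<close>)
  show "a - b = a + - b" by (simp add: minus_bop_def)
  show "r *\<^sub>C (a + b) = r *\<^sub>C a + r *\<^sub>C b" "(r + s) *\<^sub>C a = r *\<^sub>C a + s *\<^sub>C a"
    "r *\<^sub>C (s *\<^sub>C a) = (r * s) *\<^sub>C a" "1 *\<^sub>C a = a"
    by (transfer, simp add: scaleC_add_left scaleC_add_right)+
  show "a * b * c = a * (b * c)" "1 * a = a" "a * 1 = a"
    by (transfer, simp)+
  show "(a + b) * c = a * c + b * c" "(r *\<^sub>C a) * b = r *\<^sub>C (a * b)"
    by (transfer, simp)+
  show "a * (b + c) = a * b + a * c" "a * (r *\<^sub>C b) = r *\<^sub>C (a * b)"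
    by (transfer, simp add: bounded_clinear_def clinear_iff)+
qed

end

lemma app_bop_times: "app_bop (S * T) x = app_bop S (app_bop T x)"
  by (simp add: times_bop.rep_eq)

lemma app_bop_scaleC: "app_bop (c *\<^sub>C T) x = c *\<^sub>C app_bop T x"
  by (simp add: scaleC_bop.rep_eq)

lemma riesz:
  fixes f :: "'a::chilbert_space \<Rightarrow> complex"
  assumes add: "\<And>x y. f (x + y) = f x + f y" and scale: "\<And>c x. f (c *\<^sub>C x) = c * f x"
    and bound: "\<And>x. cmod (f x) \<le> norm x * K"
  shows "\<exists>z. \<forall>x. f x = cinner x z"
proof -
  define \<Phi> where "\<Phi> x = (norm x)\<^sup>2 - 2 * Re (f x)" for x
  have lower: "\<Phi> x \<ge> - K\<^sup>2" for x
  proof -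
    have "Re (f x) \<le> norm x * K" using bound[of x] complex_Re_le_cmod[of "f x"] by linarith
    moreover have "(norm x - K)\<^sup>2 \<ge> 0" by simp
    ultimately show ?thesis by (simp add: \<Phi>_def power2_diff algebra_simps)
  qed
  define m where "m = (INF x. \<Phi> x)"
  have bdd: "bdd_below (range \<Phi>)" by (rule bdd_belowI2[OF lower])
  have m_le: "m \<le> \<Phi> x" for x unfolding m_def by (rule cINF_lower[OF bdd]) simp
  have "\<exists>x. \<Phi> x < m + inverse (real (Suc n))" for n
    using cInf_lessD[of "range \<Phi>" "m + inverse (real (Suc n))"] unfolding m_def by auto
  then obtain X where X: "\<And>n. \<Phi> (X n) < m + inverse (real (Suc n))" by metis
  have mid: "(norm (x - y))\<^sup>2 \<le> 2 * (\<Phi> x - m) + 2 * (\<Phi> y - m)" for x y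
  proof -
    define h where "h = complex_of_real (1/2) *\<^sub>C (x + y)"
    have nh: "(norm h)\<^sup>2 = (norm (x + y))\<^sup>2 / 4"
      by (simp add: h_def norm_scaleC power_mult_distrib power2_eq_square)
    have fh: "Re (f h) = (Re (f x) + Re (f y)) / 2" by (simp add: h_def scale add)
    have "(norm (x + y))\<^sup>2 + (norm (x - y))\<^sup>2 = 2 * (norm x)\<^sup>2 + 2 * (norm y)\<^sup>2"
    proof -
      have "cinner x (- y) = - cinner x y" using cinner_diff_right[of x 0 y] by simp
      thus ?thesis using norm_add_square[of x y] norm_add_square[of x "- y"] by simp
    qed
    moreover have "m \<le> \<Phi> h" by (rule m_le)
    ultimately show ?thesis unfolding \<Phi>_def nh fh by (simp add: field_simps)
  qed
  have "Cauchy X"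
  proof (rule metric_CauchyI)
    fix e :: real assume e: "e > 0"
    obtain N where N: "inverse (real (Suc N)) < e\<^sup>2 / 4"
      using reals_Archimedean[of "e\<^sup>2 / 4"] e by auto
    have "dist (X i) (X j) < e" if "i \<ge> N" "j \<ge> N" for i j
    proof -
      have *: "\<Phi> (X k) - m < e\<^sup>2 / 4" if "k \<ge> N" for k
      proof -
        have "inverse (real (Suc k)) \<le> inverse (real (Suc N))"
          using that by (intro le_imp_inverse_le) auto
        hence "inverse (real (Suc k)) < e\<^sup>2 / 4" using N by (rule le_less_trans)
        thus ?thesis using X[of k] by simp
      qed
      have "(norm (X i - X j))\<^sup>2 < e\<^sup>2"
        using *[OF that(1)] *[OF that(2)] mid[of "X i" "X j"] by simp
      thus ?thesis using e by (simp add: dist_norm power_less_imp_less_base)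
    qed
    thus "\<exists>N. \<forall>i\<ge>N. \<forall>j\<ge>N. dist (X i) (X j) < e" by blast
  qed
  then obtain z where z: "X \<longlonglongrightarrow> z" using Cauchy_convergent convergent_def by blast
  have blf: "bounded_linear f"
    using assms by (auto intro!: bounded_linear_intro simp: scaleR_scaleC scaleR_conv_of_real)
  have "(\<lambda>n. \<Phi> (X n)) \<longlonglongrightarrow> \<Phi> z"
    unfolding \<Phi>_def using bounded_linear.tendsto[OF blf z] z by (intro tendsto_intros)
  moreover have "(\<lambda>n. m + inverse (real (Suc n))) \<longlonglongrightarrow> m + 0"
    by (intro tendsto_add tendsto_const LIMSEQ_inverse_real_of_nat)
  ultimately have "\<Phi> z \<le> m"
    using X by (intro LIMSEQ_le[where X = "\<lambda>n. \<Phi> (X n)"]) (auto intro: less_imp_le)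
  hence min: "\<Phi> z \<le> \<Phi> x" for x using m_le order_trans by blast
  have re: "Re (f h) = Re (cinner h z)" for h
  proof -
    define d where "d = Re (cinner h z) - Re (f h)"
    define b where "b = (norm h)\<^sup>2"
    have *: "0 \<le> t\<^sup>2 * b + 2 * t * d" for t :: real
    proof -
      have "\<Phi> (complex_of_real t *\<^sub>C h + z) = t\<^sup>2 * b + 2 * t * d + \<Phi> z"
        unfolding \<Phi>_def norm_add_square
        by (simp add: b_def d_def norm_scaleC power_mult_distrib cinner_scaleC_left add scale algebra_simps)
      thus ?thesis using min[of "complex_of_real t *\<^sub>C h + z"] by linarith
    qed
    have "d = 0"
    proof (cases "b = 0")
      case True
      hence "d\<^sup>2 \<le> 0" using *[of "-d"] by (simp add: power2_eq_square)
      thus ?thesis by simp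
    next
      case False
      hence "b > 0" by (simp add: b_def)
      have "(- d / b)\<^sup>2 * b + 2 * (- d / b) * d = - (d\<^sup>2 / b)"
        using \<open>b > 0\<close> by (simp add: power2_eq_square field_simps)
      hence "d\<^sup>2 / b \<le> 0" using *[of "- d / b"] by linarith
      thus ?thesis using \<open>b > 0\<close> by (simp add: divide_le_0_iff)
    qed
    thus ?thesis by (simp add: d_def)
  qed
  have "f x = cinner x z" for x
  proof (rule complex_eqI)
    show "Re (f x) = Re (cinner x z)" by (rule re)
    show "Im (f x) = Im (cinner x z)" using re[of "\<i> *\<^sub>C x"] by (simp add: scale cinner_scaleC_left)
  qed
  thus ?thesis by blast
qed

text \<open>The adjoint exists and is unique by Riesz representation; see \<open>cinner_adjoint\<close> below.\<close>

definition adjoint_bop :: "'a::chilbert_space bop \<Rightarrow> 'a bop"  (\<open>_\<^sup>\<star>\<close> [1000] 1000)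
  where "T\<^sup>\<star> = (THE S. \<forall>x y. cinner (app_bop T x) y = cinner x (app_bop S y))"

lemma adjoint_exists:
  fixes T :: "'a::chilbert_space bop"
  shows "\<exists>S. \<forall>x y. cinner (app_bop T x) y = cinner x (app_bop S y)"
proof -
  obtain K where K: "K \<ge> 0" "\<And>x. norm (app_bop T x) \<le> norm x * K"
    using bounded_clinear_nonneg[OF bop_bounded_clinear] by blast
  have "\<exists>z. \<forall>x. cinner (app_bop T x) y = cinner x z" for y
  proof (rule riesz)
    show "cmod (cinner (app_bop T x) y) \<le> norm x * (K * norm y)" for x
      using cauchy_schwarz[of "app_bop T x" y] mult_right_mono[OF K(2)[of x] norm_ge_zero[of y]]
      by (simp add: mult.assoc)
  qed (simp_all add: bop_add bop_scaleC cinner_add_left cinner_scaleC_left)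
  then obtain S where S: "\<And>x y. cinner (app_bop T x) y = cinner x (S y)" by metis
  have S': "cinner (S y) x = cinner y (app_bop T x)" for x y
    by (metis S cinner_commute)
  have "bounded_clinear S"
  proof (rule bounded_clinearI[where K = K])
    show "S (x + y) = S x + S y" for x y
      by (rule cinner_ext) (simp add: S' cinner_add_left)
    show "S (c *\<^sub>C x) = c *\<^sub>C S x" for c x
      by (rule cinner_ext) (simp add: S' cinner_scaleC_left)
    show "norm (S x) \<le> norm x * K" for x
    proof -
      have "(norm (S x))\<^sup>2 = cmod (cinner (S x) (S x))" by (simp add: cinner_self norm_power)
      also have "\<dots> \<le> norm x * norm (app_bop T (S x))" unfolding S' by (rule cauchy_schwarz)
      also have "\<dots> \<le> norm x * (norm (S x) * K)" by (intro mult_left_mono K) simp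
      finally have "norm (S x) * norm (S x) \<le> norm (S x) * (norm x * K)"
        by (simp add: power2_eq_square mult_ac)
      thus ?thesis using K by (cases "norm (S x) = 0") (auto simp: mult_le_cancel_left)
    qed
  qed
  hence "app_bop (Abs_bop S) = S" by (simp add: Abs_bop_inverse)
  thus ?thesis using S by metis
qed

lemma cinner_adjoint: "cinner (app_bop T x) y = cinner x (app_bop (T\<^sup>\<star>) y)"
proof -
  have "\<exists>!S. \<forall>x y. cinner (app_bop T x) y = cinner x (app_bop S y)"
  proof (rule ex_ex1I[OF adjoint_exists])
    fix S S' assume "\<forall>x y. cinner (app_bop T x) y = cinner x (app_bop S y)"
      "\<forall>x y. cinner (app_bop T x) y = cinner x (app_bop S' y)"
    hence "cinner (app_bop S y) x = cinner (app_bop S' y) x" for x y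
      by (metis cinner_commute)
    thus "S = S'" by (metis bop_eqI cinner_ext)
  qed
  from theI'[OF this] show ?thesis unfolding adjoint_bop_def by blast
qed

lemma Cauchy_diff: "Cauchy X \<Longrightarrow> Cauchy Y \<Longrightarrow> Cauchy (\<lambda>n. X n - Y n :: 'a::real_normed_vector)"
  and Cauchy_add: "Cauchy X \<Longrightarrow> Cauchy Y \<Longrightarrow> Cauchy (\<lambda>n. X n + Y n :: 'a::real_normed_vector)"
proof -
  have add: "Cauchy (\<lambda>n. X n + Y n)" if XY: "Cauchy X" "Cauchy Y" for X Y :: "nat \<Rightarrow> 'a"
  proof (rule CauchyI)
    fix e :: real assume "e > 0"
    hence "e / 2 > 0" by simp
    obtain M where M: "\<And>m n. m \<ge> M \<Longrightarrow> n \<ge> M \<Longrightarrow> norm (X m - X n) < e / 2"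
      using CauchyD[OF XY(1) \<open>e / 2 > 0\<close>] by blast
    obtain N where N: "\<And>m n. m \<ge> N \<Longrightarrow> n \<ge> N \<Longrightarrow> norm (Y m - Y n) < e / 2"
      using CauchyD[OF XY(2) \<open>e / 2 > 0\<close>] by blast
    have "norm ((X m + Y m) - (X n + Y n)) < e" if "m \<ge> max M N" "n \<ge> max M N" for m n
      using norm_diff_triangle_ineq[of "X m" "Y m" "X n" "Y n"] M[of m n] N[of m n] that
      by simp
    thus "\<exists>M. \<forall>m\<ge>M. \<forall>n\<ge>M. norm ((X m + Y m) - (X n + Y n)) < e" by blast
  qed
  show "Cauchy X \<Longrightarrow> Cauchy Y \<Longrightarrow> Cauchy (\<lambda>n. X n + Y n)" by (rule add)
  show "Cauchy X \<Longrightarrow> Cauchy Y \<Longrightarrow> Cauchy (\<lambda>n. X n - Y n)"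
    using add[of X "\<lambda>n. - Y n"] bounded_linear.Cauchy[OF bounded_linear_minus[OF bounded_linear_ident], of Y]
    by simp
qed

lemma Cauchy_uminus: "Cauchy X \<Longrightarrow> Cauchy (\<lambda>n. - X n :: 'a::real_normed_vector)"
  by (rule bounded_linear.Cauchy[OF bounded_linear_minus[OF bounded_linear_ident]])

lemma Cauchy_norm:
  fixes X :: "nat \<Rightarrow> 'a::real_normed_vector"
  assumes "Cauchy X"
  shows "Cauchy (\<lambda>n. norm (X n))"
proof (rule CauchyI)
  fix e :: real assume "e > 0"
  with CauchyD[OF assms] show "\<exists>M. \<forall>m\<ge>M. \<forall>n\<ge>M. norm (norm (X m) - norm (X n)) < e"
    by (metis norm_triangle_ineq3 order_le_less_trans real_norm_def)
qed

lemma bounded_linear_scaleC: "bounded_linear (\<lambda>x. c *\<^sub>C x :: 'a::complex_inner)"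
  by (rule bounded_linear_intro[where K = "cmod c"])
    (simp_all add: scaleC_add_right scaleR_scaleC norm_scaleC mult.commute)

lemma Cauchy_scaleC: "Cauchy X \<Longrightarrow> Cauchy (\<lambda>n. c *\<^sub>C X n :: 'a::complex_inner)"
  by (rule bounded_linear.Cauchy[OF bounded_linear_scaleC])

lemma Cauchy_cinner:
  fixes X Y :: "nat \<Rightarrow> 'a::complex_inner"
  assumes X: "Cauchy X" and Y: "Cauchy Y"
  shows "Cauchy (\<lambda>n. cinner (X n) (Y n))"
proof (rule CauchyI)
  fix e :: real assume "e > 0"
  obtain A B where A: "A > 0" "\<And>n. norm (X n) \<le> A" and B: "B > 0" "\<And>n. norm (Y n) \<le> B"
    using Cauchy_Bseq[OF X] Cauchy_Bseq[OF Y] by (metis BseqE)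
  have "e / (2 * A) > 0" "e / (2 * B) > 0" using \<open>e > 0\<close> A B by simp_all
  then obtain M N where M: "\<And>m n. m \<ge> M \<Longrightarrow> n \<ge> M \<Longrightarrow> norm (X m - X n) < e / (2 * B)"
    and N: "\<And>m n. m \<ge> N \<Longrightarrow> n \<ge> N \<Longrightarrow> norm (Y m - Y n) < e / (2 * A)"
    using CauchyD[OF X] CauchyD[OF Y] by metis
  have "norm (cinner (X m) (Y m) - cinner (X n) (Y n)) < e" if "m \<ge> max M N" "n \<ge> max M N" for m n
  proof -
    have "cinner (X m) (Y m) - cinner (X n) (Y n) = cinner (X m - X n) (Y m) + cinner (X n) (Y m - Y n)"
      by (simp add: cinner_diff_left cinner_diff_right)
    also have "norm \<dots> \<le> norm (X m - X n) * norm (Y m) + norm (X n) * norm (Y m - Y n)"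
      by (intro norm_triangle_mono cauchy_schwarz)
    also have "\<dots> \<le> norm (X m - X n) * B + A * norm (Y m - Y n)"
      using A B by (intro add_mono mult_mono) (auto intro: less_imp_le)
    also have "\<dots> < e / (2 * B) * B + A * (e / (2 * A))"
      using A B M[of m n] N[of m n] that
      by (intro add_strict_mono mult_strict_left_mono mult_strict_right_mono) auto
    also have "\<dots> = e" using A B by simp
    finally show ?thesis .
  qed
  thus "\<exists>M. \<forall>m\<ge>M. \<forall>n\<ge>M. norm (cinner (X m) (Y m) - cinner (X n) (Y n)) < e" by blast
qed

text \<open>Completion: Cauchy sequences modulo sequences converging to zero.\<close>

definition complrel :: "(nat \<Rightarrow> 'a::complex_inner) \<Rightarrow> (nat \<Rightarrow> 'a) \<Rightarrow> bool"
  where "complrel X Y \<longleftrightarrow> Cauchy X \<and> Cauchy Y \<and> (\<lambda>n. X n - Y n) \<longlonglongrightarrow> 0"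

lemma complrel_refl [simp]: "complrel X X \<longleftrightarrow> Cauchy X"
  by (simp add: complrel_def)

lemma part_equivp_complrel: "part_equivp (complrel :: (nat \<Rightarrow> 'a::complex_inner) \<Rightarrow> _)"
proof (rule part_equivpI)
  show "\<exists>X. complrel X (X :: nat \<Rightarrow> 'a)"
    by (rule exI[of _ "\<lambda>_. 0"]) (simp add: convergent_Cauchy convergent_const)
  show "symp (complrel :: (nat \<Rightarrow> 'a) \<Rightarrow> _)"
  proof (rule sympI)
    fix X Y :: "nat \<Rightarrow> 'a" assume "complrel X Y"
    thus "complrel Y X" using tendsto_minus[of "\<lambda>n. X n - Y n" 0] by (auto simp: complrel_def)
  qed
  show "transp (complrel :: (nat \<Rightarrow> 'a) \<Rightarrow> _)"
  proof (rule transpI)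
    fix X Y Z :: "nat \<Rightarrow> 'a" assume "complrel X Y" "complrel Y Z"
    thus "complrel X Z"
      using tendsto_add[of "\<lambda>n. X n - Y n" 0 sequentially "\<lambda>n. Y n - Z n" 0] by (auto simp: complrel_def)
  qed
qed

quotient_type (overloaded) 'a completion = "nat \<Rightarrow> 'a::complex_inner" / partial: complrel
  by (rule part_equivp_complrel)

lemma completion_cases:
  obtains X where "Cauchy X" "z = abs_completion X"
  by (metis Quotient3_completion Quotient3_def complrel_refl)

lemma complrel_cinner:
  assumes "complrel X X'" "complrel Y Y'"
  shows "lim (\<lambda>n. cinner (X n) (Y n)) = lim (\<lambda>n. cinner (X' n) (Y' n))"
proof -
  interpret bounded_bilinear "cinner :: 'a \<Rightarrow> 'a \<Rightarrow> complex" by (rule bounded_bilinear_cinner)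
  have X: "Cauchy X" "Cauchy X'" "(\<lambda>n. X n - X' n) \<longlonglongrightarrow> 0"
    and Y: "Cauchy Y" "Cauchy Y'" "(\<lambda>n. Y n - Y' n) \<longlonglongrightarrow> 0"
    using assms by (auto simp: complrel_def)
  have "Bfun Y sequentially" "Bfun X' sequentially"
    using X Y by (auto intro: Cauchy_Bseq)
  hence "Zfun (\<lambda>n. cinner (X n - X' n) (Y n) + cinner (X' n) (Y n - Y' n)) sequentially"
    using X Y by (intro Zfun_add Zfun_prod_Bfun Bfun_prod_Zfun) (auto simp: tendsto_Zfun_iff)
  hence *: "(\<lambda>n. cinner (X n) (Y n) - cinner (X' n) (Y' n)) \<longlonglongrightarrow> 0"
    by (simp add: tendsto_Zfun_iff cinner_diff_left cinner_diff_right)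
  obtain L where "(\<lambda>n. cinner (X' n) (Y' n)) \<longlonglongrightarrow> L"
    using Cauchy_cinner[OF X(2) Y(2)] Cauchy_convergent convergent_def by blast
  with tendsto_add[OF this *] show ?thesis by (simp add: limI)
qed

lemma complrel_norm:
  assumes "complrel X X'"
  shows "lim (\<lambda>n. norm (X n)) = lim (\<lambda>n. norm (X' n))"
proof -
  have X: "Cauchy X'" "(\<lambda>n. X n - X' n) \<longlonglongrightarrow> 0" using assms by (auto simp: complrel_def)
  have "(\<lambda>n. norm (X n) - norm (X' n)) \<longlonglongrightarrow> 0"
    by (rule Lim_null_comparison[OF _ tendsto_norm_zero[OF X(2)]]) (simp add: norm_triangle_ineq3)
  moreover have "Cauchy (\<lambda>n. norm (X' n))" using X by (rule_tac Cauchy_norm)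
  then obtain L where "(\<lambda>n. norm (X' n)) \<longlonglongrightarrow> L"
    using Cauchy_convergent convergent_def by blast
  ultimately show ?thesis
    using tendsto_add[of "\<lambda>n. norm (X' n)" L sequentially "\<lambda>n. norm (X n) - norm (X' n)" 0]
    by (simp add: limI)
qed

instantiation completion :: (complex_inner) complex_inner
begin

lift_definition zero_completion :: "'a completion" is "\<lambda>_. 0 :: 'a"
  by (simp add: convergent_Cauchy convergent_const)

lift_definition plus_completion :: "'a completion \<Rightarrow> 'a completion \<Rightarrow> 'a completion"
  is "\<lambda>X Y n. X n + Y n :: 'a"
  subgoal for X X' Y Y'
    using tendsto_add[of "\<lambda>n. X n - X' n" 0 sequentially "\<lambda>n. Y n - Y' n" 0]
    by (auto simp: complrel_def Cauchy_add algebra_simps)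
  done

lift_definition minus_completion :: "'a completion \<Rightarrow> 'a completion \<Rightarrow> 'a completion"
  is "\<lambda>X Y n. X n - Y n :: 'a"
  subgoal for X X' Y Y'
    using tendsto_diff[of "\<lambda>n. X n - X' n" 0 sequentially "\<lambda>n. Y n - Y' n" 0]
    by (auto simp: complrel_def Cauchy_diff algebra_simps)
  done

lift_definition scaleC_completion :: "complex \<Rightarrow> 'a completion \<Rightarrow> 'a completion"
  is "\<lambda>c X n. c *\<^sub>C X n :: 'a"
  subgoal for c X X'
    using bounded_linear.tendsto_zero[OF bounded_linear_scaleC, of "\<lambda>n. X n - X' n" sequentially c]
    by (auto simp: complrel_def Cauchy_scaleC complex_vector.scale_right_diff_distrib)
  done

lift_definition norm_completion :: "'a completion \<Rightarrow> real"
  is "\<lambda>X. lim (\<lambda>n. norm (X n :: 'a))" by (rule complrel_norm)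

lift_definition cinner_completion :: "'a completion \<Rightarrow> 'a completion \<Rightarrow> complex"
  is "\<lambda>X Y. lim (\<lambda>n. cinner (X n :: 'a) (Y n))" by (rule complrel_cinner)

definition uminus_completion :: "'a completion \<Rightarrow> 'a completion"
  where "- z = 0 - (z :: 'a completion)"
definition scaleR_completion :: "real \<Rightarrow> 'a completion \<Rightarrow> 'a completion"
  where "r *\<^sub>R z = complex_of_real r *\<^sub>C (z :: 'a completion)"
definition sgn_completion :: "'a completion \<Rightarrow> 'a completion"
  where "sgn z = scaleR (inverse (norm z)) (z :: 'a completion)"
definition dist_completion :: "'a completion \<Rightarrow> 'a completion \<Rightarrow> real"
  where "dist z w = norm (z - w :: 'a completion)"
definition uniformity_completion :: "('a completion \<times> 'a completion) filter"
  where "uniformity = (INF e\<in>{0<..}. principal {(z, w :: 'a completion). dist z w < e})"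
definition open_completion :: "'a completion set \<Rightarrow> bool"
  where "open U \<longleftrightarrow> (\<forall>z\<in>U. eventually (\<lambda>(z', w). z' = z \<longrightarrow> w \<in> U) (uniformity :: ('a completion \<times> _) filter))"

lemma abs_completion_eq:
  "Cauchy X \<Longrightarrow> Cauchy Y \<Longrightarrow> abs_completion X = abs_completion Y \<longleftrightarrow> (\<lambda>n. X n - Y n) \<longlonglongrightarrow> (0::'a)"
  using Quotient3_rel[OF Quotient3_completion, of X Y] by (auto simp: complrel_def)

lemma abs_completion_simps:
  fixes X Y :: "nat \<Rightarrow> 'a"
  shows "Cauchy X \<Longrightarrow> Cauchy Y \<Longrightarrow> abs_completion X + abs_completion Y = abs_completion (\<lambda>n. X n + Y n)"
    "Cauchy X \<Longrightarrow> Cauchy Y \<Longrightarrow> abs_completion X - abs_completion Y = abs_completion (\<lambda>n. X n - Y n)"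
    "Cauchy X \<Longrightarrow> c *\<^sub>C abs_completion X = abs_completion (\<lambda>n. c *\<^sub>C X n)"
  by (simp_all add: plus_completion.abs_eq minus_completion.abs_eq scaleC_completion.abs_eq)

lemma norm_abs_completion:
  fixes X :: "nat \<Rightarrow> 'a"
  assumes "Cauchy X"
  shows "(\<lambda>n. norm (X n)) \<longlonglongrightarrow> norm (abs_completion X)"
  using Cauchy_convergent[OF Cauchy_norm[OF assms]] assms
  by (simp add: norm_completion.abs_eq convergent_LIMSEQ_iff)

lemma cinner_abs_completion:
  fixes X Y :: "nat \<Rightarrow> 'a"
  assumes "Cauchy X" "Cauchy Y"
  shows "(\<lambda>n. cinner (X n) (Y n)) \<longlonglongrightarrow> cinner (abs_completion X) (abs_completion Y)"
  using Cauchy_convergent[OF Cauchy_cinner[OF assms]] assms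
  by (simp add: cinner_completion.abs_eq convergent_LIMSEQ_iff)

lemma zero_completion_eq: "(0 :: 'a completion) = abs_completion (\<lambda>_. 0)"
  by (rule zero_completion.abs_eq)

instance
proof
  fix a b c :: "'a completion" and r s :: complex and x y :: real and U :: "'a completion set"
  obtain A where A: "Cauchy A" "a = abs_completion A" by (rule completion_cases)
  obtain B where B: "Cauchy B" "b = abs_completion B" by (rule completion_cases)
  obtain C where C: "Cauchy C" "c = abs_completion C" by (rule completion_cases)
  have Z: "Cauchy (\<lambda>_. 0 :: 'a)" by (simp add: convergent_Cauchy convergent_const)
  note simps = A(2) B(2) C(2) zero_completion_eq uminus_completion_def scaleR_completion_def
    abs_completion_simps Cauchy_add Cauchy_diff Cauchy_uminus Cauchy_scaleC A(1) B(1) C(1) Z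
  show "a + b + c = a + (b + c)" "a + b = b + a" "0 + a = a" "- a + a = 0" "a - b = a + - b"
    by (simp_all add: simps algebra_simps)
  show "r *\<^sub>C (a + b) = r *\<^sub>C a + r *\<^sub>C b" "(r + s) *\<^sub>C a = r *\<^sub>C a + s *\<^sub>C a"
    "r *\<^sub>C (s *\<^sub>C a) = (r * s) *\<^sub>C a" "1 *\<^sub>C a = a"
    "x *\<^sub>R (a + b) = x *\<^sub>R a + x *\<^sub>R b" "(x + y) *\<^sub>R a = x *\<^sub>R a + y *\<^sub>R a"
    "x *\<^sub>R (y *\<^sub>R a) = (x * y) *\<^sub>R a" "1 *\<^sub>R a = a"
    by (simp_all add: simps scaleC_add_left scaleC_add_right)
  show "dist a b = norm (a - b)" "sgn a = scaleR (inverse (norm a)) a" "x *\<^sub>R a = complex_of_real x *\<^sub>C a"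
    "uniformity = (INF e\<in>{0<..}. principal {(z, w :: 'a completion). dist z w < e})"
    "open U \<longleftrightarrow> (\<forall>z\<in>U. eventually (\<lambda>(z', w). z' = z \<longrightarrow> w \<in> U) uniformity)"
    by (simp_all only: dist_completion_def sgn_completion_def scaleR_completion_def
        uniformity_completion_def open_completion_def)
  have nA: "(\<lambda>n. norm (A n)) \<longlonglongrightarrow> norm a" and nB: "(\<lambda>n. norm (B n)) \<longlonglongrightarrow> norm b"
    using norm_abs_completion A B by auto
  have nAB: "(\<lambda>n. norm (A n + B n)) \<longlonglongrightarrow> norm (a + b)"
    using norm_abs_completion[of "\<lambda>n. A n + B n"] by (simp add: simps)
  have nsA: "(\<lambda>n. norm (complex_of_real x *\<^sub>C A n)) \<longlonglongrightarrow> norm (x *\<^sub>R a)"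
    using norm_abs_completion[of "\<lambda>n. complex_of_real x *\<^sub>C A n"] by (simp add: simps)
  show "norm a = 0 \<longleftrightarrow> a = 0"
  proof -
    have "a = 0 \<longleftrightarrow> A \<longlonglongrightarrow> 0"
      using abs_completion_eq[OF A(1) Z] by (simp add: A(2) zero_completion_eq)
    also have "\<dots> \<longleftrightarrow> (\<lambda>n. norm (A n)) \<longlonglongrightarrow> 0" by (simp add: tendsto_norm_zero_iff)
    also have "\<dots> \<longleftrightarrow> norm a = 0" using nA LIMSEQ_unique[OF nA] by metis
    finally show ?thesis by simp
  qed
  show "norm (a + b) \<le> norm a + norm b"
    by (rule LIMSEQ_le[OF nAB tendsto_add[OF nA nB]]) (auto intro: norm_triangle_ineq)
  have "(\<lambda>n. norm (complex_of_real x *\<^sub>C A n)) \<longlonglongrightarrow> \<bar>x\<bar> * norm a"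
    using tendsto_mult_left[OF nA, of "\<bar>x\<bar>"] by (simp add: norm_scaleC)
  with nsA show "norm (x *\<^sub>R a) = \<bar>x\<bar> * norm a" by (rule LIMSEQ_unique)
  have cAB: "(\<lambda>n. cinner (F n) (G n)) \<longlonglongrightarrow> cinner f g"
    if "Cauchy F" "Cauchy G" "f = abs_completion F" "g = abs_completion G" for F G f g
    using cinner_abs_completion that by auto
  show "cinner a b = cnj (cinner b a)"
    using cAB[OF A(1) B(1) A(2) B(2)] tendsto_cnj[OF cAB[OF B(1) A(1) B(2) A(2)]]
    unfolding cinner_commute[symmetric] by (rule LIMSEQ_unique)
  have "(\<lambda>n. cinner (A n + B n) (C n)) \<longlonglongrightarrow> cinner (a + b) c"
    by (rule cAB) (simp_all add: simps)
  with tendsto_add[OF cAB[OF A(1) C(1) A(2) C(2)] cAB[OF B(1) C(1) B(2) C(2)]]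
  show "cinner (a + b) c = cinner a c + cinner b c"
    unfolding cinner_add_left by (rule LIMSEQ_unique[rotated])
  have "(\<lambda>n. cinner (r *\<^sub>C A n) (B n)) \<longlonglongrightarrow> cinner (r *\<^sub>C a) b"
    by (rule cAB) (simp_all add: simps)
  with tendsto_mult_left[OF cAB[OF A(1) B(1) A(2) B(2)], of r]
  show "cinner (r *\<^sub>C a) b = r * cinner a b"
    unfolding cinner_scaleC_left by (rule LIMSEQ_unique[rotated])
  have "(\<lambda>n. cinner (A n) (A n)) \<longlonglongrightarrow> complex_of_real ((norm a)\<^sup>2)"
    unfolding cinner_self by (rule tendsto_of_real[OF tendsto_power[OF nA]])
  with cAB[OF A(1) A(1) A(2) A(2)] show "cinner a a = complex_of_real ((norm a)\<^sup>2)"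
    by (rule LIMSEQ_unique)
qed

end

definition embed_completion :: "'a::complex_inner \<Rightarrow> 'a completion"
  where "embed_completion x = abs_completion (\<lambda>_. x)"

lemma Cauchy_const: "Cauchy (\<lambda>_. x :: 'a::real_normed_vector)"
  by (simp add: convergent_Cauchy convergent_const)

lemma embed_completion_add: "embed_completion (x + y) = embed_completion x + embed_completion y"
  and embed_completion_diff: "embed_completion (x - y) = embed_completion x - embed_completion y"
  and embed_completion_scaleC: "embed_completion (c *\<^sub>C x) = c *\<^sub>C embed_completion x"
  by (simp_all add: embed_completion_def abs_completion_simps Cauchy_const)

lemma norm_embed_completion: "norm (embed_completion x) = norm x"
  using norm_abs_completion[OF Cauchy_const, of x]
  by (simp add: embed_completion_def LIMSEQ_const_iff)

lemma cinner_embed_completion: "cinner (embed_completion x) (embed_completion y) = cinner x y"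
  using cinner_abs_completion[OF Cauchy_const Cauchy_const, of x y]
  by (simp add: embed_completion_def LIMSEQ_const_iff)

lemma embed_completion_tendsto:
  assumes X: "Cauchy X"
  shows "(\<lambda>n. embed_completion (X n)) \<longlonglongrightarrow> abs_completion X"
proof (rule metric_LIMSEQ_I)
  fix e :: real assume "e > 0"
  hence "e / 2 > 0" by simp
  then obtain N where N: "\<And>m n. m \<ge> N \<Longrightarrow> n \<ge> N \<Longrightarrow> norm (X m - X n) < e / 2"
    using CauchyD[OF X] by metis
  have "dist (embed_completion (X n)) (abs_completion X) < e" if "n \<ge> N" for n
  proof -
    have "(\<lambda>m. norm (X n - X m)) \<longlonglongrightarrow> norm (abs_completion (\<lambda>m. X n - X m))"
      by (intro norm_abs_completion Cauchy_diff Cauchy_const X)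
    hence "norm (abs_completion (\<lambda>m. X n - X m)) \<le> e / 2"
      by (rule LIMSEQ_le_const2) (use N that in \<open>auto intro!: exI[of _ N] less_imp_le\<close>)
    thus ?thesis using \<open>e > 0\<close>
      by (simp add: dist_norm embed_completion_def abs_completion_simps Cauchy_const X)
  qed
  thus "\<exists>N. \<forall>n\<ge>N. dist (embed_completion (X n)) (abs_completion X) < e" by blast
qed

lemma closure_range_embed_completion: "closure (range embed_completion) = UNIV"
proof -
  have "z \<in> closure (range embed_completion)" for z :: "'a completion"
  proof -
    obtain X where "Cauchy X" "z = abs_completion X" by (rule completion_cases)
    thus ?thesis using embed_completion_tendsto[of X] by (auto simp: closure_sequential intro!: exI[of _ "\<lambda>n. embed_completion (X n)"])
  qed
  thus ?thesis by blast
qed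

instance completion :: (complex_inner) chilbert_space
proof
  fix F :: "nat \<Rightarrow> 'a completion" assume F: "Cauchy F"
  have "\<exists>x. dist (embed_completion x) (F n) < inverse (real (Suc n))" for n
  proof -
    have "F n \<in> closure (range embed_completion)" by (simp add: closure_range_embed_completion)
    thus ?thesis by (auto simp: closure_approachable)
  qed
  then obtain X where X: "\<And>n. dist (embed_completion (X n)) (F n) < inverse (real (Suc n))" by metis
  have diff: "(\<lambda>n. embed_completion (X n) - F n) \<longlonglongrightarrow> 0"
    by (rule Lim_null_comparison[OF _ LIMSEQ_inverse_real_of_nat])
       (use X in \<open>simp only: dist_norm less_imp_le eventually_True\<close>)
  have "Cauchy (\<lambda>n. F n + (embed_completion (X n) - F n))"
    by (intro Cauchy_add F LIMSEQ_imp_Cauchy[OF diff])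
  hence "Cauchy (\<lambda>n. embed_completion (X n))" by simp
  hence "Cauchy X"
    by (simp add: Cauchy_def dist_norm embed_completion_diff[symmetric] norm_embed_completion)
  from tendsto_diff[OF embed_completion_tendsto[OF this] diff]
  show "convergent F" by (auto simp: convergent_def)
qed

lemma completion_extension:
  fixes f :: "'a::complex_inner \<Rightarrow> 'a"
  assumes f: "bounded_clinear f"
  shows "\<exists>T. \<forall>x. app_bop T (embed_completion x) = embed_completion (f x)"
proof -
  obtain K where K: "K \<ge> 0" "\<And>x. norm (f x) \<le> norm x * K" using bounded_clinear_nonneg[OF f] by blast
  have lin: "f (x + y) = f x + f y" "f (c *\<^sub>C x) = c *\<^sub>C f x" "f (x - y) = f x - f y" for x y c
    using f by (simp_all add: bounded_clinear_def clinear_add clinear_scaleC clinear_diff)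
  note blf = bounded_clinear_bounded_linear[OF f]
  have fC: "Cauchy (\<lambda>n. f (X n))" if "Cauchy X" for X by (rule bounded_linear.Cauchy[OF blf that])
  have "\<exists>X. Cauchy X \<and> z = abs_completion X" for z :: "'a completion"
    by (rule completion_cases[of z]) blast
  then obtain R where R: "\<And>z. Cauchy (R z)" "\<And>z :: 'a completion. z = abs_completion (R z)" by metis
  define g where "g z = abs_completion (\<lambda>n. f (R z n))" for z
  have g: "g (abs_completion X) = abs_completion (\<lambda>n. f (X n))" if "Cauchy X" for X
  proof -
    have "(\<lambda>n. R (abs_completion X) n - X n) \<longlonglongrightarrow> 0"
      by (rule abs_completion_eq[OF R(1) that, THEN iffD1, OF R(2)[symmetric]])
    from bounded_linear.tendsto_zero[OF blf this] show ?thesis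
      unfolding g_def by (simp add: abs_completion_eq fC R that lin)
  qed
  have "bounded_clinear g"
  proof (rule bounded_clinearI[where K = K])
    fix z w :: "'a completion" and c
    obtain X where X: "Cauchy X" "z = abs_completion X" by (rule completion_cases)
    obtain Y where Y: "Cauchy Y" "w = abs_completion Y" by (rule completion_cases)
    show "g (z + w) = g z + g w" "g (c *\<^sub>C z) = c *\<^sub>C g z"
      by (simp_all add: X Y g abs_completion_simps Cauchy_add Cauchy_scaleC fC lin)
    show "norm (g z) \<le> norm z * K"
      unfolding X(2) g[OF X(1)]
      by (rule LIMSEQ_le[OF norm_abs_completion[OF fC] tendsto_mult_right[OF norm_abs_completion]])
         (use X(1) K in auto)
  qed
  hence "app_bop (Abs_bop g) = g" by (simp add: Abs_bop_inverse)
  thus ?thesis using g[OF Cauchy_const] by (metis embed_completion_def)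
qed

instantiation poly_mapping :: (type, complex_vector) complex_vector
begin

definition scaleC_poly_mapping :: "complex \<Rightarrow> ('a \<Rightarrow>\<^sub>0 'b) \<Rightarrow> ('a \<Rightarrow>\<^sub>0 'b)"
  where "c *\<^sub>C f = Poly_Mapping.map (scaleC c) f"

lemma lookup_scaleC: "Poly_Mapping.lookup (c *\<^sub>C f) k = c *\<^sub>C Poly_Mapping.lookup (f :: 'a \<Rightarrow>\<^sub>0 'b) k"
  by (simp add: scaleC_poly_mapping_def Poly_Mapping.map.rep_eq when_def)

instance
  by standard (auto intro!: poly_mapping_eqI simp: lookup_scaleC lookup_add scaleC_add_left scaleC_add_right)

end

abbreviation free_gen :: "'a \<Rightarrow> 'b \<Rightarrow> ('a \<times> 'b \<Rightarrow>\<^sub>0 complex)"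
  where "free_gen x y \<equiv> Poly_Mapping.single (x, y) 1"

text \<open>The algebraic tensor product is the free vector space on \<open>'a \<times> 'b\<close> modulo the span of the
  bilinearity relations.\<close>

definition tensor_relators :: "('a::complex_vector \<times> 'b::complex_vector \<Rightarrow>\<^sub>0 complex) set"
  where "tensor_relators =
      {free_gen (x + x') y - free_gen x y - free_gen x' y | x x' y. True}
    \<union> {free_gen x (y + y') - free_gen x y - free_gen x y' | x y y'. True}
    \<union> {free_gen (c *\<^sub>C x) y - c *\<^sub>C free_gen x y | c x y. True}
    \<union> {free_gen x (c *\<^sub>C y) - c *\<^sub>C free_gen x y | c x y. True}"

definition tensor_eq ::
    "('a::complex_vector \<times> 'b::complex_vector \<Rightarrow>\<^sub>0 complex) \<Rightarrow> ('a \<times> 'b \<Rightarrow>\<^sub>0 complex) \<Rightarrow> bool"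
  where "tensor_eq f g \<longleftrightarrow> f - g \<in> complex_vector.span tensor_relators"

lemma equivp_tensor_eq:
  "equivp (tensor_eq :: ('a::complex_vector \<times> 'b::complex_vector \<Rightarrow>\<^sub>0 complex) \<Rightarrow> _)"
  (is "equivp ?R")
proof (rule equivpI)
  show "reflp ?R" by (simp add: reflp_def tensor_eq_def complex_vector.span_zero)
  show "symp ?R"
    unfolding symp_def tensor_eq_def using complex_vector.span_neg by fastforce
  show "transp ?R"
  proof (rule transpI)
    fix f g h :: "'a \<times> 'b \<Rightarrow>\<^sub>0 complex"
    assume "tensor_eq f g" "tensor_eq g h"
    thus "tensor_eq f h"
      using complex_vector.span_add[of "f - g" tensor_relators "g - h"] by (simp add: tensor_eq_def)
  qed
qed

quotient_type (overloaded) ('a, 'b) atensor =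
    "'a::complex_vector \<times> 'b::complex_vector \<Rightarrow>\<^sub>0 complex" / tensor_eq
  by (rule equivp_tensor_eq)

instantiation atensor :: (complex_vector, complex_vector) complex_vector
begin

lift_definition zero_atensor :: "('a, 'b) atensor" is 0 .

lift_definition plus_atensor :: "('a, 'b) atensor \<Rightarrow> ('a, 'b) atensor \<Rightarrow> ('a, 'b) atensor" is "(+)"
  subgoal for f f' g g'
    unfolding tensor_eq_def
    using complex_vector.span_add[of "f - f'" tensor_relators "g - g'"] by (simp add: algebra_simps)
  done

lift_definition minus_atensor :: "('a, 'b) atensor \<Rightarrow> ('a, 'b) atensor \<Rightarrow> ('a, 'b) atensor" is "(-)"
  subgoal for f f' g g'
    unfolding tensor_eq_def
    using complex_vector.span_diff[of "f - f'" tensor_relators "g - g'"] by (simp add: algebra_simps)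
  done

lift_definition uminus_atensor :: "('a, 'b) atensor \<Rightarrow> ('a, 'b) atensor" is uminus
  subgoal for f f'
    unfolding tensor_eq_def
    using complex_vector.span_neg[of "f - f'" tensor_relators] by (simp add: algebra_simps)
  done

lift_definition scaleC_atensor :: "complex \<Rightarrow> ('a, 'b) atensor \<Rightarrow> ('a, 'b) atensor" is scaleC
  subgoal for c f f'
    unfolding tensor_eq_def
    using complex_vector.span_scale[of "f - f'" tensor_relators c]
    by (simp add: complex_vector.scale_right_diff_distrib)
  done

instance
proof
  fix a b c :: "('a, 'b) atensor" and r s :: complex
  have refl: "f = g \<Longrightarrow> tensor_eq f g" for f g :: "'a \<times> 'b \<Rightarrow>\<^sub>0 complex"
    by (simp add: tensor_eq_def complex_vector.span_zero)
  show "a + b + c = a + (b + c)" "a + b = b + a" "0 + a = a" "- a + a = 0" "a - b = a + - b"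
    "r *\<^sub>C (a + b) = r *\<^sub>C a + r *\<^sub>C b" "(r + s) *\<^sub>C a = r *\<^sub>C a + s *\<^sub>C a"
    "r *\<^sub>C (s *\<^sub>C a) = (r * s) *\<^sub>C a" "1 *\<^sub>C a = a"
    by (transfer, rule refl, simp add: algebra_simps scaleC_add_left scaleC_add_right)+
qed

end

lift_definition atensor :: "'a::complex_vector \<Rightarrow> 'b::complex_vector \<Rightarrow> ('a, 'b) atensor"
  is free_gen .

definition cbilinear :: "('a::complex_vector \<Rightarrow> 'b::complex_vector \<Rightarrow> 'c::complex_vector) \<Rightarrow> bool"
  where "cbilinear B \<longleftrightarrow> (\<forall>y. clinear (\<lambda>x. B x y)) \<and> (\<forall>x. clinear (B x))"

lemma cbilinearI:
  assumes "\<And>x x' y. B (x + x') y = B x y + B x' y" "\<And>c x y. B (c *\<^sub>C x) y = c *\<^sub>C B x y"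
    "\<And>x y y'. B x (y + y') = B x y + B x y'" "\<And>c x y. B x (c *\<^sub>C y) = c *\<^sub>C B x y"
  shows "cbilinear B"
  using assms by (simp add: cbilinear_def clinear_iff)

lemma cbilinear_simps:
  assumes "cbilinear B"
  shows "B (x + x') y = B x y + B x' y" "B (c *\<^sub>C x) y = c *\<^sub>C B x y"
    "B x (y + y') = B x y + B x y'" "B x (c *\<^sub>C y) = c *\<^sub>C B x y"
  using assms by (simp_all add: cbilinear_def clinear_iff)

lemma tensor_relatorsI:
  "free_gen (x + x') y - free_gen x y - free_gen x' y \<in> tensor_relators"
  "free_gen x (y + y') - free_gen x y - free_gen x y' \<in> tensor_relators"
  "free_gen (c *\<^sub>C x) y - c *\<^sub>C free_gen x y \<in> tensor_relators"
  "free_gen x (c *\<^sub>C y) - c *\<^sub>C free_gen x y \<in> tensor_relators"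
  unfolding tensor_relators_def by blast+

lemma cbilinear_atensor: "cbilinear atensor"
proof (rule cbilinearI)
  have eqI: "tensor_eq f g" if "f - g \<in> tensor_relators" for f g :: "'a \<times> 'b \<Rightarrow>\<^sub>0 complex"
    unfolding tensor_eq_def by (rule complex_vector.span_base) (rule that)
  fix x x' :: 'a and y y' :: 'b and c
  show "atensor (x + x') y = atensor x y + atensor x' y"
    by transfer (rule eqI, unfold diff_diff_eq[symmetric], rule tensor_relatorsI)
  show "atensor x (y + y') = atensor x y + atensor x y'"
    by transfer (rule eqI, unfold diff_diff_eq[symmetric], rule tensor_relatorsI)
  show "atensor (c *\<^sub>C x) y = c *\<^sub>C atensor x y"
    by transfer (rule eqI, rule tensor_relatorsI)
  show "atensor x (c *\<^sub>C y) = c *\<^sub>C atensor x y"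
    by transfer (rule eqI, rule tensor_relatorsI)
qed

lemmas atensor_simps = cbilinear_simps[OF cbilinear_atensor]

lemma free_gen_scale: "Poly_Mapping.single (x, y) c = c *\<^sub>C free_gen x y"
  by (rule poly_mapping_eqI) (simp add: lookup_scaleC lookup_single when_def)

lemma abs_atensor_sum: "abs_atensor (\<Sum>i\<in>A. f i) = (\<Sum>i\<in>A. abs_atensor (f i))"
  by (induction A rule: infinite_finite_induct)
     (simp_all add: zero_atensor.abs_eq plus_atensor.abs_eq[symmetric])

lemma atensor_finite_sum:
  "abs_atensor f = (\<Sum>(x, y)\<in>Poly_Mapping.keys f. Poly_Mapping.lookup f (x, y) *\<^sub>C atensor x y)"
proof -
  have eq: "f = (\<Sum>p\<in>Poly_Mapping.keys f. Poly_Mapping.single p (Poly_Mapping.lookup f p))"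
    by (rule poly_mapping_eqI) (simp add: lookup_sum lookup_single when_def not_in_keys_iff_lookup_eq_zero)
  have "abs_atensor f = abs_atensor (\<Sum>p\<in>Poly_Mapping.keys f. Poly_Mapping.single p (Poly_Mapping.lookup f p))"
    by (rule arg_cong[OF eq])
  also have "\<dots> = (\<Sum>(x, y)\<in>Poly_Mapping.keys f. Poly_Mapping.lookup f (x, y) *\<^sub>C atensor x y)"
    unfolding abs_atensor_sum
  proof (rule sum.cong[OF refl], clarify)
    fix x y
    show "abs_atensor (Poly_Mapping.single (x, y) (Poly_Mapping.lookup f (x, y)))
        = Poly_Mapping.lookup f (x, y) *\<^sub>C atensor x y"
      unfolding free_gen_scale[of x y "Poly_Mapping.lookup f (x, y)"]
      by (simp add: atensor.abs_eq scaleC_atensor.abs_eq)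
  qed
  finally show ?thesis .
qed

lemma atensor_induct [case_names zero add tensor]:
  assumes "P 0" "\<And>u v. P u \<Longrightarrow> P v \<Longrightarrow> P (u + v)" "\<And>x y. P (atensor x y)"
  shows "P u"
proof (induction u rule: atensor.abs_induct)
  case (1 f)
  have sumP: "P (\<Sum>i\<in>A. g i)" if "\<And>i. P (g i)" for A and g :: "_ \<Rightarrow> ('a, 'b) atensor"
    by (induction A rule: infinite_finite_induct) (use assms that in auto)
  show ?case
    unfolding atensor_finite_sum
    by (rule sumP) (simp add: case_prod_unfold assms(3) flip: atensor_simps(2))
qed

definition free_lift ::
    "('a \<Rightarrow> 'b \<Rightarrow> 'c::complex_vector) \<Rightarrow> ('a \<times> 'b \<Rightarrow>\<^sub>0 complex) \<Rightarrow> 'c"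
  where "free_lift B f = (\<Sum>(x, y)\<in>Poly_Mapping.keys f. Poly_Mapping.lookup f (x, y) *\<^sub>C B x y)"

lemma free_lift_superset:
  assumes "finite S" "Poly_Mapping.keys f \<subseteq> S"
  shows "free_lift B f = (\<Sum>(x, y)\<in>S. Poly_Mapping.lookup f (x, y) *\<^sub>C B x y)"
  unfolding free_lift_def
  by (rule sum.mono_neutral_left) (use assms in \<open>auto simp: in_keys_iff\<close>)

lemma clinear_free_lift: "clinear (free_lift B)"
  unfolding clinear_iff
proof (intro conjI allI)
  fix f g :: "'a \<times> 'b \<Rightarrow>\<^sub>0 complex" and c
  have "free_lift B h = (\<Sum>(x, y)\<in>Poly_Mapping.keys f \<union> Poly_Mapping.keys g. Poly_Mapping.lookup h (x, y) *\<^sub>C B x y)"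
    if "h \<in> {f, g, f + g}" for h
    by (rule free_lift_superset) (use that keys_add[of f g] in auto)
  thus "free_lift B (f + g) = free_lift B f + free_lift B g"
    by (simp add: lookup_add scaleC_add_left sum.distrib case_prod_unfold)
  have "free_lift B h = (\<Sum>(x, y)\<in>Poly_Mapping.keys f. Poly_Mapping.lookup h (x, y) *\<^sub>C B x y)"
    if "h \<in> {f, c *\<^sub>C f}" for h
    by (rule free_lift_superset) (use that in \<open>auto simp: in_keys_iff lookup_scaleC\<close>)
  thus "free_lift B (c *\<^sub>C f) = c *\<^sub>C free_lift B f"
    by (simp add: lookup_scaleC complex_vector.scale_sum_right case_prod_unfold)
qed

lemma free_lift_gen: "free_lift B (free_gen x y) = B x y"
  by (simp add: free_lift_def)

definition atensor_lift ::
    "('a::complex_vector \<Rightarrow> 'b::complex_vector \<Rightarrow> 'c::complex_vector) \<Rightarrow> ('a, 'b) atensor \<Rightarrow> 'c"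
  where "atensor_lift B u = free_lift B (rep_atensor u)"

lemma atensor_lift_abs:
  assumes "cbilinear B"
  shows "atensor_lift B (abs_atensor f) = free_lift B f"
proof -
  have "free_lift B g = 0" if "g \<in> complex_vector.span tensor_relators" for g
    using that
  proof (induction rule: complex_vector.span_induct_alt)
    case base
    show ?case by (rule clinear_zero[OF clinear_free_lift])
  next
    case (step c g h)
    hence "free_lift B g = 0"
      by (auto simp: tensor_relators_def clinear_diff[OF clinear_free_lift] free_lift_gen
          clinear_scaleC[OF clinear_free_lift] cbilinear_simps[OF assms])
    with step show ?case
      by (simp add: clinear_add[OF clinear_free_lift] clinear_scaleC[OF clinear_free_lift])
  qed
  moreover have "tensor_eq (rep_atensor (abs_atensor f)) f"
    by (rule Quotient3_rep_abs[OF Quotient3_atensor]) (simp add: tensor_eq_def complex_vector.span_zero)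
  ultimately have "free_lift B (rep_atensor (abs_atensor f) - f) = 0"
    by (simp add: tensor_eq_def)
  thus ?thesis by (simp add: atensor_lift_def clinear_diff[OF clinear_free_lift])
qed

lemma atensor_lift [simp]: "cbilinear B \<Longrightarrow> atensor_lift B (atensor x y) = B x y"
  by (simp add: atensor.abs_eq atensor_lift_abs free_lift_gen)

lemma clinear_atensor_lift:
  assumes "cbilinear B"
  shows "clinear (atensor_lift B)"
  unfolding clinear_iff
proof (intro conjI allI)
  fix u v :: "('a, 'b) atensor" and c
  show "atensor_lift B (u + v) = atensor_lift B u + atensor_lift B v"
    by (induction u rule: atensor.abs_induct, induction v rule: atensor.abs_induct)
       (simp add: plus_atensor.abs_eq atensor_lift_abs assms clinear_add[OF clinear_free_lift])
  show "atensor_lift B (c *\<^sub>C u) = c *\<^sub>C atensor_lift B u"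
    by (induction u rule: atensor.abs_induct)
       (simp add: scaleC_atensor.abs_eq atensor_lift_abs assms clinear_scaleC[OF clinear_free_lift])
qed

lemma atensor_lift_fun_add:
    "atensor_lift (\<lambda>x y. B x y + B' x y) u = atensor_lift B u + atensor_lift B' u"
  by (simp add: atensor_lift_def free_lift_def scaleC_add_right case_prod_unfold sum.distrib)

lemma atensor_lift_fun_scaleC: "atensor_lift (\<lambda>x y. c *\<^sub>C B x y) u = c *\<^sub>C atensor_lift B u"
  by (simp add: atensor_lift_def free_lift_def complex_vector.scale_sum_right case_prod_unfold mult.commute)

lemma clinear_atensor_ext:
  assumes "clinear f" "clinear g" "\<And>x y. f (atensor x y) = g (atensor x y)"
  shows "f u = g u"
  by (induction u rule: atensor_induct) (simp_all add: assms clinear_zero clinear_add)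

lemma pre_inner_triangle:
  fixes q :: "'a::complex_vector \<Rightarrow> 'a \<Rightarrow> complex"
  assumes comm: "\<And>x y. q x y = cnj (q y x)" and add: "\<And>x y z. q (x + y) z = q x z + q y z"
    and scale: "\<And>c x y. q (c *\<^sub>C x) y = c * q x y" and pos: "\<And>x. Re (q x x) \<ge> 0"
  shows "sqrt (Re (q (x + y) (x + y))) \<le> sqrt (Re (q x x)) + sqrt (Re (q y y))"
proof -
  have add': "q x (y + z) = q x y + q x z" and scale': "q x (c *\<^sub>C y) = cnj c * q x y" for x y z c
    by (metis comm add complex_cnj_add, metis comm scale complex_cnj_mult)
  define a b c where "a = Re (q x x)" and "b = Re (q x y)" and "c = Re (q y y)"
  have b': "Re (q y x) = b" using comm[of y x] by (simp add: b_def)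
  have ac: "a \<ge> 0" "c \<ge> 0" by (simp_all add: a_def c_def pos)
  have quad: "0 \<le> a + 2 * t * b + t\<^sup>2 * c" for t :: real
    using pos[of "x + complex_of_real t *\<^sub>C y"] b'
    by (simp add: add add' scale scale' a_def b_def c_def power2_eq_square algebra_simps)
  have "b \<le> sqrt a * sqrt c"
  proof (cases "c = 0")
    case True
    have "b = 0"
    proof (rule ccontr)
      assume "b \<noteq> 0"
      thus False using quad[of "- (a + 1) / (2 * b)"] True by (simp add: field_simps)
    qed
    thus ?thesis using ac by simp
  next
    case False
    hence "c > 0" using ac by simp
    have "a + 2 * (- b / c) * b + (- b / c)\<^sup>2 * c = a - b\<^sup>2 / c"
      using \<open>c > 0\<close> by (simp add: power2_eq_square field_simps)
    hence "b\<^sup>2 / c \<le> a" using quad[of "- b / c"] by linarith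
    hence "b\<^sup>2 \<le> a * c" using \<open>c > 0\<close> by (simp only: pos_divide_le_eq)
    thus ?thesis by (metis real_le_rsqrt real_sqrt_mult)
  qed
  hence "a + 2 * b + c \<le> (sqrt a + sqrt c)\<^sup>2"
    using ac by (simp add: power2_sum)
  hence "sqrt (a + 2 * b + c) \<le> sqrt a + sqrt c"
    using ac by (intro real_le_lsqrt) auto
  moreover have "Re (q (x + y) (x + y)) = a + 2 * b + c"
    using b' by (simp add: add add' a_def b_def c_def)
  ultimately show ?thesis by (simp add: a_def c_def)
qed

definition orthonormal :: "'a::complex_inner set \<Rightarrow> bool"
  where "orthonormal E \<longleftrightarrow> (\<forall>e\<in>E. \<forall>e'\<in>E. cinner e e' = (if e = e' then 1 else 0))"

lemma atensor_orthonormal: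
  fixes u :: "('a::complex_inner, 'b::complex_vector) atensor"
  shows "\<exists>E w. finite E \<and> orthonormal E \<and> u = (\<Sum>e\<in>E. atensor e (w e))"
proof -
  have step: "\<exists>E w. finite E \<and> orthonormal E \<and> u + atensor x y = (\<Sum>e\<in>E. atensor e (w e))"
    if u: "\<exists>E w. finite E \<and> orthonormal E \<and> u = (\<Sum>e\<in>E. atensor e (w e))"
    for u :: "('a, 'b) atensor" and x y
  proof -
    obtain E w where E: "finite E" "orthonormal E" and u: "u = (\<Sum>e\<in>E. atensor e (w e))"
      using u by blast
    define p where "p = (\<Sum>e\<in>E. cinner x e *\<^sub>C e)"
    define r where "r = x - p"
    define w' where "w' e = w e + cinner x e *\<^sub>C y" for e
    have orth: "cinner r e = 0" if "e \<in> E" for e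
    proof -
      have "cinner p e = (\<Sum>e'\<in>E. if e' = e then cinner x e else 0)"
        unfolding p_def cinner_sum_left
        by (rule sum.cong) (use E(2) that in \<open>auto simp: cinner_scaleC_left orthonormal_def\<close>)
      thus ?thesis using E(1) that by (simp add: r_def cinner_diff_left)
    qed
    have sum: "atensor (\<Sum>e\<in>E. f e) y = (\<Sum>e\<in>E. atensor (f e) y)" for f :: "'a \<Rightarrow> 'a"
      by (rule clinear_sum) (simp add: clinear_iff atensor_simps)
    have "u + atensor x y = (\<Sum>e\<in>E. atensor e (w' e)) + atensor r y"
    proof -
      have "x = p + r" by (simp add: r_def)
      hence "atensor x y = (\<Sum>e\<in>E. atensor (cinner x e *\<^sub>C e) y) + atensor r y"
        unfolding sum[symmetric] p_def[symmetric] by (metis atensor_simps(1))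
      thus ?thesis
        by (simp add: u w'_def atensor_simps sum.distrib)
    qed
    show ?thesis
    proof (cases "r = 0")
      case True
      hence "atensor r y = 0" using atensor_simps(2)[of 0 0 y] by simp
      thus ?thesis using E \<open>u + atensor x y = _\<close> by auto
    next
      case False
      define e0 where "e0 = complex_of_real (inverse (norm r)) *\<^sub>C r"
      have r: "r = complex_of_real (norm r) *\<^sub>C e0" using False by (simp add: e0_def)
      have "norm e0 = 1" using False by (simp add: e0_def norm_scaleC norm_inverse)
      hence "cinner e0 e0 = 1" by (simp add: cinner_self)
      moreover have e0: "cinner e0 e = 0" "cinner e e0 = 0" if "e \<in> E" for e
        using orth[OF that] cinner_commute[of e r]
        by (simp_all add: e0_def cinner_scaleC_left cinner_scaleC_right)
      ultimately have new: "e0 \<notin> E" by fastforce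
      have "orthonormal (insert e0 E)"
        using E(2) e0 \<open>cinner e0 e0 = 1\<close> new by (auto simp: orthonormal_def)
      moreover have "atensor r y = atensor e0 (complex_of_real (norm r) *\<^sub>C y)"
        by (subst r) (simp only: atensor_simps)
      hence "u + atensor x y = (\<Sum>e\<in>insert e0 E. atensor e ((w'(e0 := complex_of_real (norm r) *\<^sub>C y)) e))"
        using \<open>u + atensor x y = _\<close> E(1) new
        by (simp add: add.commute) (intro sum.cong, auto)
      ultimately show ?thesis using E(1) by blast
    qed
  qed
  have "\<forall>v. (\<exists>E w. finite E \<and> orthonormal E \<and> v = (\<Sum>e\<in>E. atensor e (w e)))
    \<longrightarrow> (\<exists>E w. finite E \<and> orthonormal E \<and> v + u = (\<Sum>e\<in>E. atensor e (w e)))"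
  proof (induction u rule: atensor_induct)
    case (add u v)
    thus ?case by (metis add.assoc)
  qed (use step in auto)
  moreover have "\<exists>E w. finite E \<and> orthonormal E \<and> (0::('a, 'b) atensor) = (\<Sum>e\<in>E. atensor e (w e))"
    by (intro exI[of _ "{}"]) (simp add: orthonormal_def)
  ultimately show ?thesis by (metis add_0)
qed

instantiation atensor :: (complex_inner, complex_inner) complex_inner
begin

text \<open>The inner product is determined by
  \<open>cinner (atensor x y) (atensor x' y') = cinner x x' * cinner y y'\<close>; see \<open>cinner_atensor\<close>.\<close>

definition cinner_atensor_def: "cinner (u :: ('a, 'b) atensor) v =
  atensor_lift (\<lambda>x y. cnj (atensor_lift (\<lambda>x' y'. cinner x' x * cinner y' y) v)) u"

definition norm_atensor :: "('a, 'b) atensor \<Rightarrow> real"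
  where "norm u = sqrt (Re (cinner u (u :: ('a, 'b) atensor)))"
definition scaleR_atensor :: "real \<Rightarrow> ('a, 'b) atensor \<Rightarrow> ('a, 'b) atensor"
  where "r *\<^sub>R u = complex_of_real r *\<^sub>C (u :: ('a, 'b) atensor)"
definition sgn_atensor :: "('a, 'b) atensor \<Rightarrow> ('a, 'b) atensor"
  where "sgn u = scaleR (inverse (norm u)) (u :: ('a, 'b) atensor)"
definition dist_atensor :: "('a, 'b) atensor \<Rightarrow> ('a, 'b) atensor \<Rightarrow> real"
  where "dist u v = norm (u - v :: ('a, 'b) atensor)"
definition uniformity_atensor :: "(('a, 'b) atensor \<times> ('a, 'b) atensor) filter"
  where "uniformity = (INF e\<in>{0<..}. principal {(u, v :: ('a, 'b) atensor). dist u v < e})"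
definition open_atensor :: "('a, 'b) atensor set \<Rightarrow> bool"
  where "open U \<longleftrightarrow> (\<forall>u\<in>U. eventually (\<lambda>(u', v). u' = u \<longrightarrow> v \<in> U) (uniformity :: (('a, 'b) atensor \<times> _) filter))"

lemma cbilinear_cinner_mult: "cbilinear (\<lambda>x' y'. cinner x' x * cinner y' y)"
  by (rule cbilinearI) (simp_all add: cinner_add_left cinner_scaleC_left algebra_simps)

lemma cbilinear_cinner_lift:
  "cbilinear (\<lambda>x y. cnj (atensor_lift (\<lambda>x' y'. cinner x' (x :: 'a) * cinner y' (y :: 'b)) v))"
proof (rule cbilinearI)
  fix x z :: 'a and y w :: 'b and c
  note [simp] = cinner_add_right cinner_scaleC_right distrib_left distrib_right
    atensor_lift_fun_add
  have *: "atensor_lift (\<lambda>x' y'. c * (cinner x' x * cinner y' y)) v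
      = c * atensor_lift (\<lambda>x' y'. cinner x' x * cinner y' y) v" for c x y
    using atensor_lift_fun_scaleC[where B = "\<lambda>x' y'. cinner x' x * cinner y' y" and c = c and u = v] by simp
  show "cnj (atensor_lift (\<lambda>x' y'. cinner x' (x + z) * cinner y' y) v)
      = cnj (atensor_lift (\<lambda>x' y'. cinner x' x * cinner y' y) v)
        + cnj (atensor_lift (\<lambda>x' y'. cinner x' z * cinner y' y) v)"
    "cnj (atensor_lift (\<lambda>x' y'. cinner x' x * cinner y' (y + w)) v)
      = cnj (atensor_lift (\<lambda>x' y'. cinner x' x * cinner y' y) v)
        + cnj (atensor_lift (\<lambda>x' y'. cinner x' x * cinner y' w) v)"
    by simp_all
  show "cnj (atensor_lift (\<lambda>x' y'. cinner x' (c *\<^sub>C x) * cinner y' y) v)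
      = c *\<^sub>C cnj (atensor_lift (\<lambda>x' y'. cinner x' x * cinner y' y) v)"
    using *[of "cnj c" x y] by (simp add: mult_ac)
  show "cnj (atensor_lift (\<lambda>x' y'. cinner x' x * cinner y' (c *\<^sub>C y)) v)
      = c *\<^sub>C cnj (atensor_lift (\<lambda>x' y'. cinner x' x * cinner y' y) v)"
    using *[of "cnj c" x y] by (simp add: mult_ac)
qed

lemma cinner_atensor:
  "cinner (atensor x y) (atensor x' y' :: ('a, 'b) atensor) = cinner x x' * cinner y y'"
  unfolding cinner_atensor_def
  by (rule trans[OF atensor_lift[OF cbilinear_cinner_lift]])
     (simp add: cbilinear_cinner_mult cinner_commute[of x x'] cinner_commute[of y y'])

lemma cinner_atensor_linear:
  fixes u v w :: "('a, 'b) atensor"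
  shows "cinner (u + v) w = cinner u w + cinner v w" "cinner (c *\<^sub>C u) w = c * cinner u w"
    "cinner 0 w = 0" "cinner u (v + w) = cinner u v + cinner u w" "cinner u 0 = 0"
proof -
  note lin = clinear_atensor_lift[OF cbilinear_cinner_lift]
  show "cinner (u + v) w = cinner u w + cinner v w" "cinner (c *\<^sub>C u) w = c * cinner u w" "cinner 0 w = 0"
    unfolding cinner_atensor_def
    by (simp_all add: clinear_add[OF lin] clinear_scaleC[OF lin] clinear_zero[OF lin])
  show "cinner u (v + w) = cinner u v + cinner u w" "cinner u 0 = 0"
    unfolding cinner_atensor_def
    by (simp_all add: clinear_add[OF clinear_atensor_lift[OF cbilinear_cinner_mult]]
        clinear_zero[OF clinear_atensor_lift[OF cbilinear_cinner_mult]] atensor_lift_fun_add)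
       (simp add: atensor_lift_def free_lift_def)
qed

lemma cinner_atensor_commute: "cinner u v = cnj (cinner v (u :: ('a, 'b) atensor))"
proof (induction u rule: atensor_induct)
  case (tensor x y)
  show ?case
    by (induction v rule: atensor_induct)
       (simp_all add: cinner_atensor_linear cinner_atensor cinner_commute[of x] cinner_commute[of y])
qed (simp_all add: cinner_atensor_linear)

lemma cinner_atensor_orthonormal:
  assumes "finite E" "orthonormal E"
  shows "cinner (\<Sum>e\<in>E. atensor e (w e)) (\<Sum>e\<in>E. atensor e (w' e) :: ('a, 'b) atensor)
    = (\<Sum>e\<in>E. cinner (w e) (w' e))"
proof -
  have l: "cinner (\<Sum>e\<in>F. g e) u = (\<Sum>e\<in>F. cinner (g e) u)"
    and r: "cinner u (\<Sum>e\<in>F. g e) = (\<Sum>e\<in>F. cinner u (g e))"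
    for F and g :: "'a \<Rightarrow> ('a, 'b) atensor" and u
    by (induction F rule: infinite_finite_induct) (simp_all add: cinner_atensor_linear)
  have "cinner (\<Sum>e\<in>E. atensor e (w e)) (\<Sum>e\<in>E. atensor e (w' e) :: ('a, 'b) atensor)
      = (\<Sum>e\<in>E. \<Sum>e'\<in>E. if e = e' then cinner (w e) (w' e') else 0)"
    unfolding l r
    by (intro sum.cong refl) (use assms(2) in \<open>auto simp: cinner_atensor orthonormal_def\<close>)
  also have "\<dots> = (\<Sum>e\<in>E. cinner (w e) (w' e))"
    by (intro sum.cong refl) (simp add: assms(1))
  finally show ?thesis .
qed

lemma cinner_atensor_self:
  assumes "finite E" "orthonormal E"
  shows "cinner (\<Sum>e\<in>E. atensor e (w e)) (\<Sum>e\<in>E. atensor e (w e) :: ('a, 'b) atensor)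
    = complex_of_real (\<Sum>e\<in>E. (norm (w e))\<^sup>2)"
  unfolding cinner_atensor_orthonormal[OF assms] by (simp add: cinner_self)

instance
proof
  fix a b c :: "('a, 'b) atensor" and r s :: complex and x y :: real and U :: "('a, 'b) atensor set"
  have pos: "Re (cinner u u) \<ge> 0" for u :: "('a, 'b) atensor"
  proof -
    obtain E w where "finite E" "orthonormal E" "u = (\<Sum>e\<in>E. atensor e (w e))"
      using atensor_orthonormal by blast
    thus ?thesis by (simp only: cinner_atensor_self Re_complex_of_real sum_nonneg zero_le_power2)
  qed
  show "x *\<^sub>R (a + b) = x *\<^sub>R a + x *\<^sub>R b" "(x + y) *\<^sub>R a = x *\<^sub>R a + y *\<^sub>R a"
    "x *\<^sub>R (y *\<^sub>R a) = (x * y) *\<^sub>R a" "1 *\<^sub>R a = a"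
    by (simp_all add: scaleR_atensor_def scaleC_add_left scaleC_add_right)
  show "dist a b = norm (a - b)" "sgn a = scaleR (inverse (norm a)) a" "x *\<^sub>R a = complex_of_real x *\<^sub>C a"
    "uniformity = (INF e\<in>{0<..}. principal {(u, v :: ('a, 'b) atensor). dist u v < e})"
    "open U \<longleftrightarrow> (\<forall>u\<in>U. eventually (\<lambda>(u', v). u' = u \<longrightarrow> v \<in> U) uniformity)"
    by (simp_all only: dist_atensor_def sgn_atensor_def scaleR_atensor_def
        uniformity_atensor_def open_atensor_def)
  show "cinner a b = cnj (cinner b a)" by (rule cinner_atensor_commute)
  show "cinner (a + b) c = cinner a c + cinner b c" "cinner (r *\<^sub>C a) b = r * cinner a b"
    by (rule cinner_atensor_linear)+
  have "Im (cinner a a) = 0" using cinner_atensor_commute[of a a] by (simp add: complex_eq_iff)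
  thus "cinner a a = complex_of_real ((norm a)\<^sup>2)"
    using pos[of a] by (simp add: norm_atensor_def complex_eq_iff)
  show "norm a = 0 \<longleftrightarrow> a = 0"
  proof
    obtain E w where E: "finite E" "orthonormal E" and a: "a = (\<Sum>e\<in>E. atensor e (w e))"
      using atensor_orthonormal by blast
    assume "norm a = 0"
    hence "(\<Sum>e\<in>E. (norm (w e))\<^sup>2) = 0"
      using cinner_atensor_self[OF E, of w] by (simp add: norm_atensor_def a)
    hence w: "w e = 0" if "e \<in> E" for e using E(1) that by (simp add: sum_nonneg_eq_0_iff)
    have "atensor e (0 :: 'b) = 0" for e :: 'a using atensor_simps(4)[of e 0 0] by simp
    with w show "a = 0" by (simp add: a)
  qed (simp add: norm_atensor_def cinner_atensor_linear)
  show "norm (a + b) \<le> norm a + norm b"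
    unfolding norm_atensor_def
    by (rule pre_inner_triangle) (auto simp: cinner_atensor_linear pos intro: cinner_atensor_commute)
  have "cinner a (complex_of_real x *\<^sub>C a) = complex_of_real x * cinner a a"
  proof -
    have "cinner a (complex_of_real x *\<^sub>C a) = cnj (cinner (complex_of_real x *\<^sub>C a) a)"
      by (rule cinner_atensor_commute)
    also have "\<dots> = complex_of_real x * cnj (cinner a a)" by (simp add: cinner_atensor_linear)
    finally show ?thesis by (simp only: cinner_atensor_commute[of a a, symmetric])
  qed
  thus "norm (x *\<^sub>R a) = \<bar>x\<bar> * norm a"
    by (simp add: norm_atensor_def scaleR_atensor_def cinner_atensor_linear real_sqrt_mult
        mult.assoc[symmetric])
qed

end

lemma norm_atensor_sum:
  assumes "finite E" "orthonormal E"
  shows "(norm (\<Sum>e\<in>E. atensor e (w e)))\<^sup>2 = (\<Sum>e\<in>E. (norm (w e))\<^sup>2)"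
  using cinner_atensor_self[OF assms, of w] unfolding cinner_self of_real_eq_iff .

lemma bounded_clinear_id_atensor:
  fixes T :: "'b::complex_inner bop"
  defines "f \<equiv> atensor_lift (\<lambda>(x::'a::complex_inner) y. atensor x (app_bop T y))"
  shows "bounded_clinear f"
proof -
  have bil: "cbilinear (\<lambda>(x::'a) y. atensor x (app_bop T y))"
    by (rule cbilinearI) (simp_all add: atensor_simps bop_add bop_scaleC)
  have lin: "clinear f" unfolding f_def by (rule clinear_atensor_lift[OF bil])
  obtain K where K: "K \<ge> 0" "\<And>x. norm (app_bop T x) \<le> norm x * K"
    using bounded_clinear_nonneg[OF bop_bounded_clinear] by blast
  have "norm (f u) \<le> norm u * K" for u
  proof -
    obtain E w where E: "finite E" "orthonormal E" and u: "u = (\<Sum>e\<in>E. atensor e (w e))"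
      using atensor_orthonormal by blast
    have "f u = (\<Sum>e\<in>E. atensor e (app_bop T (w e)))"
      unfolding u clinear_sum[OF lin] by (simp add: f_def bil)
    hence "(norm (f u))\<^sup>2 = (\<Sum>e\<in>E. (norm (app_bop T (w e)))\<^sup>2)"
      by (simp add: norm_atensor_sum[OF E])
    also have "\<dots> \<le> (\<Sum>e\<in>E. (norm (w e) * K)\<^sup>2)"
      by (intro sum_mono power_mono K) simp
    also have "\<dots> = (norm u * K)\<^sup>2"
      by (simp add: u power_mult_distrib norm_atensor_sum[OF E] sum_distrib_right)
    finally show ?thesis by (rule power2_le_imp_le) (simp add: K)
  qed
  thus ?thesis using lin unfolding bounded_clinear_def by blast
qed

definition atensor_swap :: "('a::complex_inner, 'b::complex_inner) atensor \<Rightarrow> ('b, 'a) atensor"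
  where "atensor_swap = atensor_lift (\<lambda>x y. atensor y x)"

lemma cbilinear_swap: "cbilinear (\<lambda>x y. atensor y x)"
  by (rule cbilinearI) (simp_all add: atensor_simps)

lemma clinear_atensor_swap: "clinear atensor_swap"
  unfolding atensor_swap_def by (rule clinear_atensor_lift[OF cbilinear_swap])

lemma atensor_swap [simp]: "atensor_swap (atensor x y) = atensor y x"
  by (simp add: atensor_swap_def cbilinear_swap)

lemma norm_atensor_swap: "norm (atensor_swap u) = norm u"
proof -
  note lin = clinear_add[OF clinear_atensor_swap] clinear_zero[OF clinear_atensor_swap]
  have "cinner (atensor_swap u) (atensor_swap v) = cinner u v" for v
  proof (induction u rule: atensor_induct)
    case (tensor x y)
    show ?case
      by (induction v rule: atensor_induct) (simp_all add: lin cinner_add_right cinner_atensor)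
  qed (simp_all add: lin cinner_add_left)
  from this[of u] have "(norm (atensor_swap u))\<^sup>2 = (norm u)\<^sup>2"
    unfolding cinner_self of_real_eq_iff .
  thus ?thesis by simp
qed

lemma bounded_clinear_atensor_map:
  fixes S :: "'a::complex_inner bop" and T :: "'b::complex_inner bop"
  shows "bounded_clinear (atensor_lift (\<lambda>x y. atensor (app_bop S x) (app_bop T y)))"
    (is "bounded_clinear ?h")
proof -
  define f where "f = atensor_lift (\<lambda>(x::'a) y. atensor x (app_bop T y))"
  define g where "g = atensor_lift (\<lambda>(x::'b) y. atensor x (app_bop S y))"
  have bil: "cbilinear (\<lambda>(x::'c::complex_inner) (y::'d::complex_inner). atensor x (app_bop R y))" for R
    by (rule cbilinearI) (simp_all add: atensor_simps bop_add bop_scaleC)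
  have bilh: "cbilinear (\<lambda>x y. atensor (app_bop S x) (app_bop T y))"
    by (rule cbilinearI) (simp_all add: atensor_simps bop_add bop_scaleC)
  have f: "bounded_clinear f" and g: "bounded_clinear g"
    unfolding f_def g_def by (rule bounded_clinear_id_atensor)+
  note lin = clinear_add clinear_scaleC
  have lin': "clinear f" "clinear g" "clinear ?h"
    using f g clinear_atensor_lift[OF bilh] by (simp_all add: bounded_clinear_def)
  have eq: "?h u = atensor_swap (g (atensor_swap (f u)))" for u
  proof (rule clinear_atensor_ext[OF lin'(3)])
    show "clinear (\<lambda>u. atensor_swap (g (atensor_swap (f u))))"
      using lin' clinear_atensor_swap[where 'a = 'a and 'b = 'b]
        clinear_atensor_swap[where 'a = 'b and 'b = 'a] unfolding clinear_iff by simp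
  qed (simp add: f_def g_def bil bilh)
  obtain K where K: "K \<ge> 0" "\<And>u. norm (f u) \<le> norm u * K"
    using bounded_clinear_nonneg[OF f] by blast
  obtain L where L: "L \<ge> 0" "\<And>u. norm (g u) \<le> norm u * L"
    using bounded_clinear_nonneg[OF g] by blast
  have "norm (?h u) \<le> norm u * (K * L)" for u
  proof -
    have "norm (?h u) \<le> norm (f u) * L"
      unfolding eq norm_atensor_swap using L(2)[of "atensor_swap (f u)"] by (simp add: norm_atensor_swap)
    also have "\<dots> \<le> norm u * K * L" using K L by (intro mult_right_mono) auto
    finally show ?thesis by (simp add: mult.assoc)
  qed
  thus ?thesis using lin'(3) unfolding bounded_clinear_def by blast
qed

text \<open>The Hilbert space tensor product is the completion of the algebraic one. Together,
  \<open>cinner_htensor\<close>, \<open>cbilinear_htensor\<close> and \<open>htensor_total\<close> characterize it up to a unitary.\<close>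

type_synonym ('a, 'b) htensor = "('a, 'b) atensor completion"

definition htensor :: "'a::complex_inner \<Rightarrow> 'b::complex_inner \<Rightarrow> ('a, 'b) htensor"
  where "htensor x y = embed_completion (atensor x y)"

lemma cbilinear_htensor: "cbilinear htensor"
  by (rule cbilinearI) (simp_all add: htensor_def atensor_simps embed_completion_add embed_completion_scaleC)

lemma cinner_htensor: "cinner (htensor x y) (htensor x' y') = cinner x x' * cinner y y'"
  by (simp add: htensor_def cinner_embed_completion cinner_atensor)

lemma htensor_total: "closure (complex_vector.span (range (case_prod htensor))) = UNIV"
proof -
  have "embed_completion u \<in> complex_vector.span (range (case_prod htensor))" for u :: "('a, 'b) atensor"
  proof (induction u rule: atensor_induct)
    case zero
    have "embed_completion (0 :: ('a, 'b) atensor) = 0" using embed_completion_diff[of 0 0] by simp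
    thus ?case by (simp only: complex_vector.span_zero)
  next
    case (add u v)
    thus ?case by (simp add: embed_completion_add complex_vector.span_add)
  next
    case (tensor x y)
    show ?case by (rule complex_vector.span_base) (auto simp: htensor_def)
  qed
  hence "range embed_completion \<subseteq> complex_vector.span (range (case_prod (htensor :: 'a \<Rightarrow> 'b \<Rightarrow> _)))"
    by blast
  from closure_mono[OF this] show ?thesis by (auto simp: closure_range_embed_completion)
qed

text \<open>\<open>S \<otimes>\<^sub>o T\<close> is the bounded operator with \<open>(S \<otimes>\<^sub>o T) (x \<otimes> y) = S x \<otimes> T y\<close>; existence and
  uniqueness are \<open>tensor_bop_ex1\<close>.\<close>

definition tensor_bop :: "'a::complex_inner bop \<Rightarrow> 'b::complex_inner bop \<Rightarrow> ('a, 'b) htensor bop"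
    (infixr \<open>\<otimes>\<^sub>o\<close> 70)
  where "S \<otimes>\<^sub>o T = (THE R. \<forall>x y. app_bop R (htensor x y) = htensor (app_bop S x) (app_bop T y))"

lemma tensor_bop_ex1:
  "\<exists>!R. \<forall>x y. app_bop R (htensor x y) = htensor (app_bop S x) (app_bop T y)"
proof (rule ex_ex1I)
  have "cbilinear (\<lambda>x y. atensor (app_bop S x) (app_bop T y))"
    by (rule cbilinearI) (simp_all add: atensor_simps bop_add bop_scaleC)
  thus "\<exists>R. \<forall>x y. app_bop R (htensor x y) = htensor (app_bop S x) (app_bop T y)"
    using completion_extension[OF bounded_clinear_atensor_map[of S T]] unfolding htensor_def by (metis atensor_lift)
next
  fix R R'
  assume "\<forall>x y. app_bop R (htensor x y) = htensor (app_bop S x) (app_bop T y)"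
    "\<forall>x y. app_bop R' (htensor x y) = htensor (app_bop S x) (app_bop T y)"
  hence eq: "app_bop R (htensor x y) = app_bop R' (htensor x y)" for x y by simp
  have cont: "continuous_on UNIV (app_bop Q)" for Q :: "('a, 'b) htensor bop"
    by (intro linear_continuous_on bounded_clinear_bounded_linear bop_bounded_clinear)
  define V where "V = {z. app_bop R z = app_bop R' z}"
  have "closed V" unfolding V_def by (intro closed_Collect_eq cont)
  have "z \<in> V" if "z \<in> complex_vector.span (range (case_prod htensor))" for z
    using that
  proof (induction rule: complex_vector.span_induct_alt)
    case base
    show ?case by (simp add: V_def clinear_zero[OF bop_clinear])
  next
    case (step c x y)
    thus ?case using eq by (auto simp: V_def bop_add bop_scaleC)
  qed
  hence "closure (complex_vector.span (range (case_prod htensor))) \<subseteq> V"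
    by (intro closure_minimal \<open>closed V\<close>) blast
  thus "R = R'" by (intro bop_eqI) (auto simp: htensor_total V_def)
qed

lemma app_tensor_bop: "app_bop (S \<otimes>\<^sub>o T) (htensor x y) = htensor (app_bop S x) (app_bop T y)"
  using theI'[OF tensor_bop_ex1[of S T]] unfolding tensor_bop_def by blast

definition gamma :: "nat \<Rightarrow> 'a::complex_algebra_1 \<Rightarrow> 'a \<Rightarrow> 'a"
  where "gamma n S T = (\<Sum>k=0..n. ((-1) ^ (n - k) * of_nat (n choose k)) *\<^sub>C (S ^ k * T ^ (n - k)))"

definition n_symmetry :: "nat \<Rightarrow> 'a::chilbert_space bop \<Rightarrow> bool"
  where "n_symmetry n T \<longleftrightarrow> gamma n (T\<^sup>\<star>) T = 0"

definition left_invertible :: "'a::complex_inner bop \<Rightarrow> bool"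
  where "left_invertible T \<longleftrightarrow> (\<exists>L. L * T = 1)"

end

theory Submission
  imports Defs "HOL-Computational_Algebra.Fundamental_Theorem_Algebra"
begin

text \<open>Suppose for a moment that both operators are invertible. For vectors \<open>x, x'\<close> consider the sequence
  \<open>f(k) = \<langle>T1\<^bsup>-k\<^esup> x, T1\<^sup>k x'\<rangle>\<close>, and define \<open>g\<close> likewise for \<open>T2\<close>. With the forward difference \<open>\<Delta>\<close>,
  the operator \<open>T1\<close> is an \<open>l\<close>-symmetry iff \<open>\<Delta>\<^sup>l f = 0\<close> for all such \<open>f\<close>, that is, iff all of them are polynomials of
  degree below \<open>l\<close>; and since inner products of pure tensors factor, \<open>T1 \<otimes>\<^sub>o T2\<close> is an \<open>n\<close>-symmetry iff
  \<open>\<Delta>\<^sup>n (f g)(0) = 0\<close> for all \<open>f\<close> and \<open>g\<close> (\<open>n_symmetry_iff_fdiff\<close>, \<open>n_symmetry_tensor_iff_fdiff\<close>). A unimodular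
  scalar in front of an operator multiplies its sequences by a geometric sequence.

  One implication is then additivity of degrees, \<open>fdiff_power_mult_eq_0\<close>. Conversely, fixing one \<open>g\<close>
  with \<open>g(0) \<noteq> 0\<close> gives a linear recurrence satisfied by all \<open>f\<close>, so some combination of shifts of an \<open>f\<close> is a
  geometric sequence \<open>\<alpha>\<^sup>k\<close>. Inserting it into the relation shows that \<open>\<alpha>\<^sup>k g(k)\<close> is polynomial for all \<open>g\<close>, and then the same
  holds for \<open>\<alpha>\<^bsup>-k\<^esup> f(k)\<close>. Products of polynomials have exactly additive degrees, which gives the bound on
  \<open>l + m\<close> (\<open>null_family_unipotent\<close>). Conjugation reverses the sequences \<open>f\<close>, and this forces \<open>\<bar>\<alpha>\<bar> = 1\<close>
  (\<open>null_family_split\<close>). A square root of \<open>\<alpha>\<close> is the scalar in the theorem.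

  Invertibility is where left invertibility enters (\<open>left_invertible_homogeneous_relation\<close>). Each of the
  symmetry conditions yields a nontrivial relation \<open>\<Sum>\<^sub>k c\<^sub>k (T\<^sup>\<star>)\<^sup>k T\<^bsup>n-k\<^esup> = 0\<close>. It confines the approximate
  point spectrum of \<open>T\<close> to finitely many lines through \<open>0\<close>, and left invertibility removes \<open>0\<close> from it. Along a ray avoiding
  those lines all \<open>T - z\<close> are bounded below, so invertibility for large \<open>z\<close> propagates to \<open>z = 0\<close>.\<close>

section \<open>Forward differences of complex sequences\<close>

definition fdiff :: "(nat \<Rightarrow> complex) \<Rightarrow> nat \<Rightarrow> complex"
  where "fdiff f = (\<lambda>k. f (Suc k) - f k)"

text \<open>Pascal's rule inside a weighted sum over the pairs \<open>(j, n - j)\<close>. It carries the induction step of both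
  the binomial expansion and the Leibniz rule for \<open>fdiff ^^ n\<close>.\<close>

lemma binomial_sum_Suc:
  fixes A :: "nat \<Rightarrow> nat \<Rightarrow> complex"
  shows "(\<Sum>j\<le>Suc n. of_nat (Suc n choose j) * A j (Suc n - j))
    = (\<Sum>j\<le>n. of_nat (n choose j) * (A (Suc j) (n - j) + A j (Suc (n - j))))"
proof -
  have "(\<Sum>j\<le>n. of_nat (n choose j) * A j (Suc (n - j)))
      = (\<Sum>j\<le>Suc n. of_nat (n choose j) * A j (Suc n - j))"
    by (auto intro!: sum.cong simp: Suc_diff_le)
  also have "\<dots> = A 0 (Suc n) + (\<Sum>j\<le>n. of_nat (n choose Suc j) * A (Suc j) (n - j))"
    by (subst sum.atMost_Suc_shift) simp
  finally show ?thesis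
    by (subst sum.atMost_Suc_shift) (simp add: algebra_simps sum.distrib)
qed

lemma fdiff_power:
  "(fdiff ^^ n) f k = (\<Sum>i\<le>n. of_nat (n choose i) * ((-1) ^ (n - i) * f (k + i)))"
proof (induction n arbitrary: k)
  case (Suc n)
  have "(fdiff ^^ Suc n) f k = (\<Sum>i\<le>n. of_nat (n choose i) * ((-1) ^ (n - i) * f (k + Suc i)
      + (-1) ^ Suc (n - i) * f (k + i)))"
    by (simp add: fdiff_def Suc.IH sum_subtractf[symmetric] algebra_simps)
  also have "\<dots> = (\<Sum>i\<le>Suc n. of_nat (Suc n choose i) * ((-1) ^ (Suc n - i) * f (k + i)))"
    by (rule binomial_sum_Suc[symmetric])
  finally show ?case .
qed simp

text \<open>The increment of a product is \<open>\<Delta>(f g)(k) = \<Delta>f(k) g(k+1) + f(k) \<Delta>g(k)\<close>; the argument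
  of \<open>g\<close> therefore moves by one each time a difference falls on \<open>f\<close>.\<close>

lemma fdiff_Leibniz:
  "(fdiff ^^ n) (\<lambda>k. f k * g k) k
    = (\<Sum>j\<le>n. of_nat (n choose j) * ((fdiff ^^ j) f k * (fdiff ^^ (n - j)) g (k + j)))"
proof (induction n arbitrary: k)
  case (Suc n)
  have "(fdiff ^^ Suc n) (\<lambda>k. f k * g k) k
     = (\<Sum>j\<le>n. of_nat (n choose j) * ((fdiff ^^ j) f (Suc k) * (fdiff ^^ (n - j)) g (Suc k + j)))
     - (\<Sum>j\<le>n. of_nat (n choose j) * ((fdiff ^^ j) f k * (fdiff ^^ (n - j)) g (k + j)))"
    by (simp only: funpow.simps comp_def fdiff_def[of "(fdiff ^^ n) _"] Suc.IH)
  also have "\<dots> = (\<Sum>j\<le>n. of_nat (n choose j) * ((fdiff ^^ Suc j) f k * (fdiff ^^ (n - j)) g (k + Suc j)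
      + (fdiff ^^ j) f k * (fdiff ^^ Suc (n - j)) g (k + j)))"
    unfolding sum_subtractf[symmetric]
    by (intro sum.cong refl) (simp add: fdiff_def algebra_simps)
  also have "\<dots> = (\<Sum>j\<le>Suc n. of_nat (Suc n choose j)
      * ((fdiff ^^ j) f k * (fdiff ^^ (Suc n - j)) g (k + j)))"
    by (rule binomial_sum_Suc[symmetric])
  finally show ?case .
qed simp

lemma fdiff_power_zero [simp]: "(fdiff ^^ n) (\<lambda>_. 0) = (\<lambda>_. 0)"
  by (induction n) (simp_all add: fdiff_def)

lemma fdiff_power_mono:
  assumes "(fdiff ^^ l) f = (\<lambda>_. 0)" "l \<le> n"
  shows "(fdiff ^^ n) f = (\<lambda>_. 0)"
proof -
  have "(fdiff ^^ n) f = (fdiff ^^ (n - l)) ((fdiff ^^ l) f)"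
    using assms(2) by (simp add: funpow_add[symmetric, THEN fun_cong, unfolded comp_def])
  thus ?thesis using assms(1) by simp
qed

text \<open>A sequence killed by \<open>\<Delta>\<^sup>l\<close> is a polynomial of degree below \<open>l\<close>, so this is
  additivity of degrees. It is the easy implication of the theorem in disguise.\<close>

lemma fdiff_power_mult_eq_0:
  assumes "(fdiff ^^ l) f = (\<lambda>_. 0)" "(fdiff ^^ m) g = (\<lambda>_. 0)" "l + m \<le> Suc n"
  shows "(fdiff ^^ n) (\<lambda>k. f k * g k) = (\<lambda>_. 0)"
proof
  fix k
  have *: "(fdiff ^^ j) f k * (fdiff ^^ (n - j)) g (k + j) = 0" for j
  proof (cases "l \<le> j")
    case True
    thus ?thesis using fdiff_power_mono[OF assms(1)] by simp
  next
    case False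
    hence "m \<le> n - j" using assms(3) by simp
    thus ?thesis using fdiff_power_mono[OF assms(2)] by simp
  qed
  show "(fdiff ^^ n) (\<lambda>k. f k * g k) k = 0"
    unfolding fdiff_Leibniz by (intro sum.neutral ballI) (subst *, rule mult_zero_right)
qed

lemma fdiff_eq_0_const:
  assumes "fdiff f = (\<lambda>_. 0)"
  shows "f k = f 0"
proof (induction k)
  case (Suc k)
  thus ?case using fun_cong[OF assms, of k] by (simp add: fdiff_def)
qed simp

lemma fdiff_power_add: "(fdiff ^^ n) (\<lambda>k. f k + g k) k = (fdiff ^^ n) f k + (fdiff ^^ n) g k"
  by (simp add: fdiff_power sum.distrib algebra_simps)

lemma fdiff_power_scale: "(fdiff ^^ n) (\<lambda>k. c * f k) k = c * (fdiff ^^ n) f k"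
  by (simp add: fdiff_power sum_distrib_left algebra_simps)

lemma fdiff_power_geometric: "(fdiff ^^ n) (\<lambda>k. c * z ^ k) 0 = c * (z - 1) ^ n"
proof -
  have "(z + (-1)) ^ n = (\<Sum>i\<le>n. of_nat (n choose i) * z ^ i * (-1) ^ (n - i))"
    by (rule binomial_ring)
  thus ?thesis by (simp add: fdiff_power sum_distrib_left mult_ac)
qed

text \<open>The sequence \<open>f g\<close> satisfies \<open>\<Delta>\<^sup>n(f g)(0) = 0\<close> even after \<open>f\<close> and \<open>g\<close> are shifted
  independently of each other. Independent shifts make the relation stable under applying
  difference operators to only one of the two factors.\<close>

definition null_pair :: "nat \<Rightarrow> (nat \<Rightarrow> complex) \<Rightarrow> (nat \<Rightarrow> complex) \<Rightarrow> bool"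
  where "null_pair n f g \<longleftrightarrow> (\<forall>i j. (fdiff ^^ n) (\<lambda>k. f (k + i) * g (k + j)) 0 = 0)"

lemma null_pair_commute: "null_pair n f g \<longleftrightarrow> null_pair n g f"
  by (auto simp: null_pair_def mult.commute)

lemma null_pair_fdiff_left: "null_pair n f g \<Longrightarrow> null_pair n (fdiff f) g"
proof -
  assume *: "null_pair n f g"
  have "(fdiff ^^ n) (\<lambda>k. fdiff f (k + i) * g (k + j)) 0 = 0" for i j
  proof -
    have "(\<lambda>k. fdiff f (k + i) * g (k + j))
      = (\<lambda>k. f (k + Suc i) * g (k + j) + (- 1) * (f (k + i) * g (k + j)))"
      by (simp add: fdiff_def algebra_simps)
    thus ?thesis using * unfolding null_pair_def by (simp only: fdiff_power_add fdiff_power_scale) simp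
  qed
  thus ?thesis by (simp add: null_pair_def)
qed

lemma null_pair_fdiff_power:
  assumes "null_pair n f g"
  shows "null_pair n ((fdiff ^^ a) f) ((fdiff ^^ b) g)"
proof -
  have *: "null_pair n ((fdiff ^^ a) f) g" if "null_pair n f g" for f g :: "nat \<Rightarrow> complex" and a
    using that by (induction a) (simp_all add: null_pair_fdiff_left)
  show ?thesis using *[OF assms] * null_pair_commute by blast
qed

text \<open>Here \<open>\<Delta>\<close> is nilpotent on \<open>G\<close>. Let \<open>m\<close> be the least exponent with \<open>\<Delta>\<^sup>m = 0\<close> on \<open>G\<close>. Some \<open>g\<close> has a nonzero
  constant as its difference of order \<open>m - 1\<close>, and inserting this constant into the relation makes \<open>\<Delta>\<close> nilpotent on \<open>F\<close>
  too, with least exponent \<open>l\<close>, say. Products of polynomial sequences of exact degrees \<open>l - 1\<close> and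
  \<open>m - 1\<close> have exact degree \<open>l + m - 2\<close>, which forces \<open>l + m \<le> n + 1\<close>; enlarging \<open>m\<close> gives equality.\<close>

lemma null_family_unipotent:
  assumes null: "\<And>f g. f \<in> F \<Longrightarrow> g \<in> G \<Longrightarrow> null_pair n f g"
    and F: "f\<^sub>0 \<in> F" "f\<^sub>0 \<noteq> (\<lambda>_. 0)" and G: "g\<^sub>0 \<in> G" "g\<^sub>0 \<noteq> (\<lambda>_. 0)"
    and ex: "\<And>g. g \<in> G \<Longrightarrow> (fdiff ^^ n) g = (\<lambda>_. 0)"
  obtains l m where "l \<ge> 1" "m \<ge> 1" "l + m = n + 1"
    "\<And>f. f \<in> F \<Longrightarrow> (fdiff ^^ l) f = (\<lambda>_. 0)" "\<And>g. g \<in> G \<Longrightarrow> (fdiff ^^ m) g = (\<lambda>_. 0)"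
proof -
  \<comment> \<open>With the least exponent \<open>Suc l\<close> killing a family, some \<open>\<Delta>\<^sup>l f\<close> is nonzero, hence a nonzero constant.\<close>
  have least: "\<exists>l c f. (\<forall>f\<in>A. (fdiff ^^ Suc l) f = (\<lambda>_. 0)) \<and> f \<in> A \<and> c \<noteq> 0 \<and> (fdiff ^^ l) f = (\<lambda>_. c)"
    if A: "\<forall>f\<in>A. (fdiff ^^ n) f = (\<lambda>_. 0)" "a \<in> A" "a \<noteq> (\<lambda>_. 0)" for A and a :: "nat \<Rightarrow> complex"
  proof -
    define P where "P l \<longleftrightarrow> (\<forall>f\<in>A. (fdiff ^^ l) f = (\<lambda>_. 0))" for l
    have "P n" using A(1) by (simp add: P_def)
    moreover have "\<not> P 0" using A(2,3) by (auto simp: P_def)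
    ultimately obtain l where l: "\<not> P l" "P (Suc l)"
      using ex_least_nat_less[of P n] by blast
    then obtain f where f: "f \<in> A" "(fdiff ^^ l) f \<noteq> (\<lambda>_. 0)" by (auto simp: P_def)
    have "fdiff ((fdiff ^^ l) f) = (\<lambda>_. 0)" using l(2) f(1) by (simp add: P_def)
    hence "(fdiff ^^ l) f k = (fdiff ^^ l) f 0" for k by (rule fdiff_eq_0_const)
    hence const: "(fdiff ^^ l) f = (\<lambda>_. (fdiff ^^ l) f 0)" by blast
    hence "(fdiff ^^ l) f 0 \<noteq> 0" using f(2) by auto
    thus ?thesis using l(2) f(1) const unfolding P_def by blast
  qed
  obtain m d g where m: "\<forall>g\<in>G. (fdiff ^^ Suc m) g = (\<lambda>_. 0)"
    and g: "g \<in> G" "d \<noteq> 0" "(fdiff ^^ m) g = (\<lambda>_. d)"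
    using least[of G g\<^sub>0] ex G by blast
  have "(fdiff ^^ n) f = (\<lambda>_. 0)" if f: "f \<in> F" for f
  proof
    fix k
    have "null_pair n f (\<lambda>_. d)"
      using null_pair_fdiff_power[OF null[OF f g(1)], of 0 m] g(3) by simp
    hence "(fdiff ^^ n) (\<lambda>i. d * f (i + k)) 0 = 0"
      by (simp add: null_pair_def mult.commute)
    thus "(fdiff ^^ n) f k = 0" using g(2) by (simp add: fdiff_power_scale) (simp add: fdiff_power add.commute)
  qed
  then obtain l c f where l: "\<forall>f\<in>F. (fdiff ^^ Suc l) f = (\<lambda>_. 0)"
    and f: "f \<in> F" "c \<noteq> 0" "(fdiff ^^ l) f = (\<lambda>_. c)"
    using least[of F f\<^sub>0] F by blast
  have le: "l + m < n"
  proof (rule ccontr)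
    assume "\<not> l + m < n"
    hence n: "n \<le> l + m" by simp
    \<comment> \<open>Lower both sequences by differences so that in \<open>\<Delta>\<^sup>n(u v)\<close> the Leibniz term of index \<open>i\<close>
      consists of the two top constants, while in every other term one factor is differenced too often.\<close>
    define i where "i = min n l"
    have i: "i \<le> n" "i \<le> l" "n - i \<le> m" using n by (auto simp: i_def)
    define u where "u = (fdiff ^^ (l - i)) f"
    define v where "v = (fdiff ^^ (m - (n - i))) g"
    have u: "(fdiff ^^ j) u = (fdiff ^^ (l - i + j)) f" for j
      by (simp add: u_def funpow_add add.commute[of "l - i"])
    have v: "(fdiff ^^ j) v = (fdiff ^^ (m - (n - i) + j)) g" for j
      by (simp add: v_def funpow_add add.commute[of "m - (n - i)"])
    have "null_pair n u v" unfolding u_def v_def by (intro null_pair_fdiff_power null f g)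
    hence "(fdiff ^^ n) (\<lambda>k. u (k + 0) * v (k + 0)) 0 = 0" unfolding null_pair_def by blast
    hence "0 = (fdiff ^^ n) (\<lambda>k. u k * v k) 0" by simp
    also have "\<dots> = (\<Sum>j\<le>n. if j = i then of_nat (n choose i) * (c * d) else 0)"
      unfolding fdiff_Leibniz
    proof (intro sum.cong refl)
      fix j assume "j \<in> {..n}"
      hence j: "j \<le> n" by simp
      consider "j = i" | "j > i" | "j < i" by linarith
      thus "of_nat (n choose j) * ((fdiff ^^ j) u 0 * (fdiff ^^ (n - j)) v (0 + j))
          = (if j = i then of_nat (n choose i) * (c * d) else 0)"
      proof cases
        case 1
        have "l - i + i = l" "m - (n - i) + (n - i) = m" using i by simp_all
        thus ?thesis using 1 f(3) g(3) by (simp only: u v refl if_True)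
      next
        case 2
        hence "(fdiff ^^ (l - i + j)) f = (\<lambda>_. 0)"
          using i by (intro fdiff_power_mono[OF bspec[OF l f(1)]]) linarith
        thus ?thesis using 2 by (simp add: u)
      next
        case 3
        hence "(fdiff ^^ (m - (n - i) + (n - j))) g = (\<lambda>_. 0)"
          using i j by (intro fdiff_power_mono[OF bspec[OF m g(1)]]) linarith
        thus ?thesis using 3 by (simp add: v)
      qed
    qed
    also have "\<dots> = of_nat (n choose i) * (c * d)" using i by simp
    finally show False using i f(2) g(2) by simp
  qed
  show ?thesis
  proof (rule that[of "Suc l" "n - l"])
    show "(fdiff ^^ (n - l)) g = (\<lambda>_. 0)" if "g \<in> G" for g
      using le by (intro fdiff_power_mono[OF bspec[OF m that]]) linarith
    show "(fdiff ^^ Suc l) f = (\<lambda>_. 0)" if "f \<in> F" for f using l that by blast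
  qed (use le in auto)
qed

section \<open>Shift-invariant families with vanishing differences of products\<close>

text \<open>This is \<open>p(E) f\<close> for the shift operator \<open>E\<close>.\<close>

definition poly_shift :: "complex poly \<Rightarrow> (nat \<Rightarrow> complex) \<Rightarrow> nat \<Rightarrow> complex"
  where "poly_shift p f = (\<lambda>k. \<Sum>i\<le>degree p. coeff p i * f (k + i))"

lemma poly_shift_eq:
  assumes "degree p \<le> N"
  shows "poly_shift p f k = (\<Sum>i\<le>N. coeff p i * f (k + i))"
  unfolding poly_shift_def
  using assms by (intro sum.mono_neutral_left) (auto simp: coeff_eq_0 not_le)

lemma poly_shift_linear_factor:
  "poly_shift ([:- a, 1:] * q) f k = poly_shift q f (Suc k) - a * poly_shift q f k"
proof -
  define N where "N = degree q"
  have "degree ([:- a, 1:] * q) \<le> Suc N"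
    using degree_mult_le[of "[:- a, 1:]" q] by (simp add: N_def)
  hence "poly_shift ([:- a, 1:] * q) f k = (\<Sum>i\<le>Suc N. coeff ([:- a, 1:] * q) i * f (k + i))"
    by (rule poly_shift_eq)
  also have "\<dots> = (\<Sum>i\<le>Suc N. coeff (pCons 0 q) i * f (k + i)) - a * (\<Sum>i\<le>Suc N. coeff q i * f (k + i))"
    by (simp only: sum_distrib_left sum_subtractf[symmetric], intro sum.cong refl) (simp add: algebra_simps)
  also have "(\<Sum>i\<le>Suc N. coeff q i * f (k + i)) = poly_shift q f k"
    by (rule poly_shift_eq[symmetric]) (simp add: N_def)
  also have "(\<Sum>i\<le>Suc N. coeff (pCons 0 q) i * f (k + i)) = poly_shift q f (Suc k)"
    by (subst sum.atMost_Suc_shift) (simp add: poly_shift_def N_def)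
  finally show ?thesis .
qed

lemma null_pair_poly_shift:
  assumes "null_pair n f g"
  shows "null_pair n (poly_shift p f) g"
proof -
  have "(fdiff ^^ n) (\<lambda>k. poly_shift p f (k + i) * g (k + j)) 0 = 0" for i j
  proof -
    have "(fdiff ^^ n) (\<lambda>k. poly_shift p f (k + i) * g (k + j)) 0
      = (\<Sum>r\<le>degree p. coeff p r * (fdiff ^^ n) (\<lambda>k. f (k + (i + r)) * g (k + j)) 0)"
      unfolding fdiff_power poly_shift_def sum_distrib_left sum_distrib_right
      by (subst sum.swap) (simp add: mult_ac add_ac)
    thus ?thesis using assms by (simp add: null_pair_def)
  qed
  thus ?thesis by (simp add: null_pair_def)
qed

text \<open>If \<open>r\<close> is a common annihilator of least degree and \<open>\<alpha>\<close> one of its roots, then \<open>r = (X - \<alpha>) q\<close> and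
  \<open>q\<close> does not annihilate \<open>F\<close>; any nonzero \<open>q(E) f\<close> is an eigenvector of the shift for \<open>\<alpha>\<close>.\<close>

lemma geometric_in_shift_span:
  assumes "p \<noteq> 0" and p: "\<And>f. f \<in> F \<Longrightarrow> poly_shift p f = (\<lambda>_. 0)"
    and "f\<^sub>0 \<in> F" "f\<^sub>0 \<noteq> (\<lambda>_. 0)"
  obtains q f \<alpha> c where "f \<in> F" "c \<noteq> 0" "poly_shift q f = (\<lambda>k. c * \<alpha> ^ k)"
proof -
  define P where "P d \<longleftrightarrow> (\<exists>p. p \<noteq> 0 \<and> degree p = d \<and> (\<forall>f\<in>F. poly_shift p f = (\<lambda>_. 0)))" for d
  have "P (degree p)" using assms by (auto simp: P_def)
  define d where "d = (LEAST d. P d)"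
  have "P d" unfolding d_def by (rule LeastI) fact
  then obtain r where r: "r \<noteq> 0" "degree r = d" "\<And>f. f \<in> F \<Longrightarrow> poly_shift r f = (\<lambda>_. 0)"
    by (auto simp: P_def)
  have "d \<noteq> 0"
  proof
    assume "d = 0"
    hence "coeff r 0 * f\<^sub>0 k = 0" for k
      using fun_cong[OF r(3)[OF assms(3)], of k] r(2) by (simp add: poly_shift_def)
    moreover have "coeff r 0 \<noteq> 0" using r \<open>d = 0\<close> by (metis leading_coeff_0_iff)
    ultimately show False using assms(4) by auto
  qed
  hence "\<not> constant (poly r)" using r(2) by (simp add: constant_degree)
  then obtain \<alpha> where "poly r \<alpha> = 0" using fundamental_theorem_of_algebra by blast
  then obtain q where q: "r = [:- \<alpha>, 1:] * q" by (metis poly_eq_0_iff_dvd dvdE)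
  have "q \<noteq> 0" using q r(1) by auto
  have "degree r = Suc (degree q)" unfolding q using \<open>q \<noteq> 0\<close> by (subst degree_mult_eq) auto
  hence "\<not> P (degree q)" using r(2) not_less_Least[of "degree q" P] by (simp add: d_def)
  then obtain f where f: "f \<in> F" "poly_shift q f \<noteq> (\<lambda>_. 0)" using \<open>q \<noteq> 0\<close> by (auto simp: P_def)
  define c where "c = poly_shift q f 0"
  have eq: "poly_shift q f k = c * \<alpha> ^ k" for k
  proof (induction k)
    case (Suc k)
    have "poly_shift q f (Suc k) = \<alpha> * poly_shift q f k"
      using fun_cong[OF r(3)[OF f(1)], of k] unfolding q poly_shift_linear_factor by simp
    thus ?case using Suc by simp
  qed (simp add: c_def)
  moreover have "c \<noteq> 0" using f(2) eq by auto
  ultimately show ?thesis using that[of f c q \<alpha>] f(1) by blast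
qed

text \<open>Geometric factors with inverse ratios cancel in products, so an eigenvalue \<open>\<alpha>\<close> of the shift on one
  family can be normalised to \<open>1\<close> at the cost of multiplying the other eigenvalue by \<open>\<alpha>\<close>.\<close>

lemma null_pair_twist:
  assumes "null_pair n f g" "\<alpha> \<noteq> 0"
  shows "null_pair n (\<lambda>k. inverse \<alpha> ^ k * f k) (\<lambda>k. \<alpha> ^ k * g k)"
proof -
  have "(\<lambda>k. inverse \<alpha> ^ (k + i) * f (k + i) * (\<alpha> ^ (k + j) * g (k + j)))
      = (\<lambda>k. inverse \<alpha> ^ i * \<alpha> ^ j * (f (k + i) * g (k + j)))" for i j
    using assms(2) by (auto simp: power_add field_simps)
  thus ?thesis using assms(1) by (simp only: null_pair_def fdiff_power_scale) simp
qed

text \<open>The combinatorial core. A geometric sequence \<open>\<alpha>\<^sup>k\<close> in the shift span of \<open>F\<close> turns the relation into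
  \<open>\<Delta>\<^sup>n(\<alpha>\<^sup>k g) = 0\<close> for all \<open>g\<close>, and after twisting both families by \<open>\<alpha>\<close> the unipotent
  case applies. The reflection hypothesis says that conjugation exchanges an initial segment of a
  sequence with its reversal; it turns the annihilator \<open>(E - \<alpha>)\<^sup>l\<close> of \<open>F\<close> into
  \<open>(cnj \<alpha> E - 1)\<^sup>l\<close>, and applying that to \<open>\<alpha>\<^sup>k\<close> gives \<open>(\<bar>\<alpha>\<bar>\<^sup>2 - 1)\<^sup>l = 0\<close>.\<close>

lemma null_family_split:
  assumes F_shift: "\<And>f. f \<in> F \<Longrightarrow> (\<lambda>k. f (Suc k)) \<in> F"
    and G_shift: "\<And>g. g \<in> G \<Longrightarrow> (\<lambda>k. g (Suc k)) \<in> G"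
    and F_refl: "\<And>f N. f \<in> F \<Longrightarrow> \<exists>f'\<in>F. \<forall>k\<le>N. f' k = cnj (f (N - k))"
    and F0: "f\<^sub>0 \<in> F" "f\<^sub>0 \<noteq> (\<lambda>_. 0)" and G0: "g\<^sub>0 \<in> G" "g\<^sub>0 0 \<noteq> 0"
    and null: "\<And>f g. f \<in> F \<Longrightarrow> g \<in> G \<Longrightarrow> (fdiff ^^ n) (\<lambda>k. f k * g k) 0 = 0"
  obtains l m \<alpha> where "l \<ge> 1" "m \<ge> 1" "l + m = n + 1" "cmod \<alpha> = 1"
    "\<And>f. f \<in> F \<Longrightarrow> (fdiff ^^ l) (\<lambda>k. inverse \<alpha> ^ k * f k) = (\<lambda>_. 0)"
    "\<And>g. g \<in> G \<Longrightarrow> (fdiff ^^ m) (\<lambda>k. \<alpha> ^ k * g k) = (\<lambda>_. 0)"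
proof -
  have shift: "(\<lambda>k. f (k + i)) \<in> A" if "\<And>f. f \<in> A \<Longrightarrow> (\<lambda>k. f (Suc k)) \<in> A" "f \<in> A"
    for A and f :: "nat \<Rightarrow> complex" and i
  proof (induction i)
    case (Suc i)
    show ?case using that(1)[OF Suc] by simp
  qed (simp add: that(2))
  have np: "null_pair n f g" if "f \<in> F" "g \<in> G" for f g
    unfolding null_pair_def
    by (intro allI null shift[of F f, OF F_shift that(1)] shift[of G g, OF G_shift that(2)])
  \<comment> \<open>Read as a condition on \<open>F\<close>, the relation with \<open>g\<^sub>0\<close> is a common annihilating polynomial.\<close>
  define p where "p = (\<Sum>i\<le>n. monom (of_nat (n choose i) * ((-1) ^ (n - i) * g\<^sub>0 i)) i)"
  have cp: "coeff p i = (if i \<le> n then of_nat (n choose i) * ((-1) ^ (n - i) * g\<^sub>0 i) else 0)" for i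
    by (simp add: p_def coeff_sum)
  have "coeff p 0 \<noteq> 0" using G0 by (simp add: cp)
  hence "p \<noteq> 0" by auto
  have "degree p \<le> n" by (rule degree_le) (simp add: cp)
  have "poly_shift p f k = 0" if "f \<in> F" for f k
    unfolding poly_shift_eq[OF \<open>degree p \<le> n\<close>]
    using null[OF shift[of F f k, OF F_shift that] G0(1)] by (simp add: fdiff_power cp mult_ac add_ac)
  hence "poly_shift p f = (\<lambda>_. 0)" if "f \<in> F" for f using that by blast
  then obtain q h \<alpha> c where h: "h \<in> F" "c \<noteq> 0" "poly_shift q h = (\<lambda>k. c * \<alpha> ^ k)"
    using geometric_in_shift_span[OF \<open>p \<noteq> 0\<close> _ F0] by metis
  have geo: "(fdiff ^^ n) (\<lambda>k. \<alpha> ^ k * g (k + j)) 0 = 0" if "g \<in> G" for g j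
  proof -
    have "(fdiff ^^ n) (\<lambda>k. c * (\<alpha> ^ k * g (k + j))) 0 = 0"
      using null_pair_poly_shift[OF np[OF h(1) that], of q, unfolded h(3) null_pair_def, rule_format, of 0 j]
      by (simp add: mult.assoc)
    thus ?thesis using h(2) by (simp add: fdiff_power_scale)
  qed
  have "\<alpha> \<noteq> 0"
  proof
    assume "\<alpha> = 0"
    hence "(\<Sum>i\<le>n. of_nat (n choose i) * ((-1) ^ (n - i) * (\<alpha> ^ i * g\<^sub>0 i))) = (-1) ^ n * g\<^sub>0 0"
      by (subst sum.remove[of _ 0]) (auto intro!: sum.neutral)
    thus False using geo[OF G0(1), of 0] G0(2) by (simp add: fdiff_power)
  qed
  define F' where "F' = (\<lambda>f k. inverse \<alpha> ^ k * f k) ` F"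
  define G' where "G' = (\<lambda>g k. \<alpha> ^ k * g k) ` G"
  have "(fdiff ^^ n) (\<lambda>k. \<alpha> ^ k * g k) k = 0" if "g \<in> G" for g k
  proof -
    have "(fdiff ^^ n) (\<lambda>k. \<alpha> ^ k * g k) k = \<alpha> ^ k * (fdiff ^^ n) (\<lambda>i. \<alpha> ^ i * g (i + k)) 0"
      by (simp add: fdiff_power power_add sum_distrib_left mult_ac add_ac)
    thus ?thesis using geo[OF that] by simp
  qed
  hence ex: "(fdiff ^^ n) g = (\<lambda>_. 0)" if "g \<in> G'" for g
    using that by (auto simp: G'_def)
  have np': "null_pair n f g" if "f \<in> F'" "g \<in> G'" for f g
    using that null_pair_twist[OF np \<open>\<alpha> \<noteq> 0\<close>] by (auto simp: F'_def G'_def)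
  have F'0: "(\<lambda>k. inverse \<alpha> ^ k * f\<^sub>0 k) \<in> F'" "(\<lambda>k. inverse \<alpha> ^ k * f\<^sub>0 k) \<noteq> (\<lambda>_. 0)"
    using F0 \<open>\<alpha> \<noteq> 0\<close> by (auto simp: F'_def fun_eq_iff)
  have G'0: "(\<lambda>k. \<alpha> ^ k * g\<^sub>0 k) \<in> G'" "(\<lambda>k. \<alpha> ^ k * g\<^sub>0 k) \<noteq> (\<lambda>_. 0)"
    using G0 \<open>\<alpha> \<noteq> 0\<close> by (auto simp: G'_def dest!: fun_cong[where x = 0])
  obtain l m where lm: "l \<ge> 1" "m \<ge> 1" "l + m = n + 1"
    "\<And>f. f \<in> F' \<Longrightarrow> (fdiff ^^ l) f = (\<lambda>_. 0)" "\<And>g. g \<in> G' \<Longrightarrow> (fdiff ^^ m) g = (\<lambda>_. 0)"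
    using null_family_unipotent[OF np' F'0 G'0 ex] by blast
  have Fl: "(fdiff ^^ l) (\<lambda>k. inverse \<alpha> ^ k * f k) = (\<lambda>_. 0)" if "f \<in> F" for f
    using lm(4)[OF imageI[OF that, where f = "\<lambda>f k. inverse \<alpha> ^ k * f k", folded F'_def]] .
  have refl: "(fdiff ^^ l) (\<lambda>k. cnj \<alpha> ^ k * f k) 0 = 0" if f: "f \<in> F" for f
  proof -
    obtain f' where f': "f' \<in> F" "\<And>k. k \<le> l \<Longrightarrow> f' k = cnj (f (l - k))"
      using F_refl[OF f, of l] by blast
    have "0 = cnj (\<alpha> ^ l * (fdiff ^^ l) (\<lambda>k. inverse \<alpha> ^ k * f' k) 0)"
      using Fl[OF f'(1)] by simp
    also have "\<dots> = (\<Sum>k\<le>l. of_nat (l choose k) * ((-1) ^ (l - k) * (cnj \<alpha> ^ (l - k) * f (l - k))))"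
      unfolding fdiff_power sum_distrib_left cnj_sum
    proof (intro sum.cong refl)
      fix k assume "k \<in> {..l}"
      moreover from this have "\<alpha> ^ l = \<alpha> ^ k * \<alpha> ^ (l - k)" by (simp add: power_add[symmetric])
      ultimately show "cnj (\<alpha> ^ l * (of_nat (l choose k) * ((-1) ^ (l - k) * (inverse \<alpha> ^ (0 + k) * f' (0 + k)))))
        = of_nat (l choose k) * ((-1) ^ (l - k) * (cnj \<alpha> ^ (l - k) * f (l - k)))"
        using \<open>\<alpha> \<noteq> 0\<close> f'(2)[of k] by (simp add: power_inverse)
    qed
    also have "\<dots> = (\<Sum>k\<le>l. of_nat (l choose k) * ((-1) ^ k * (cnj \<alpha> ^ k * f k)))"
      by (rule sum.reindex_bij_witness[of _ "\<lambda>k. l - k" "\<lambda>k. l - k"]) (auto simp: binomial_symmetric[symmetric])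
    also have "\<dots> = (\<Sum>k\<le>l. (-1) ^ l * (of_nat (l choose k) * ((-1) ^ (l - k) * (cnj \<alpha> ^ k * f k))))"
      by (intro sum.cong refl) (simp add: minus_one_power_iff)
    also have "\<dots> = (-1) ^ l * (fdiff ^^ l) (\<lambda>k. cnj \<alpha> ^ k * f k) 0"
      by (simp add: fdiff_power sum_distrib_left)
    finally show ?thesis by simp
  qed
  \<comment> \<open>The reflected relation, carried over from \<open>F\<close> to the geometric sequence \<open>q(E) h\<close>.\<close>
  have "0 = (\<Sum>r\<le>degree q. coeff q r * (fdiff ^^ l) (\<lambda>k. cnj \<alpha> ^ k * h (k + r)) 0)"
    using refl[OF shift[of F h, OF F_shift h(1)]] by simp
  also have "\<dots> = (fdiff ^^ l) (\<lambda>k. cnj \<alpha> ^ k * poly_shift q h k) 0"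
    unfolding fdiff_power poly_shift_def sum_distrib_left sum_distrib_right
    by (subst sum.swap) (simp add: mult_ac add_ac)
  also have "\<dots> = (fdiff ^^ l) (\<lambda>k. c * (cnj \<alpha> * \<alpha>) ^ k) 0"
    by (simp add: h(3) power_mult_distrib mult_ac)
  also have "\<dots> = c * (cnj \<alpha> * \<alpha> - 1) ^ l" by (rule fdiff_power_geometric)
  finally have "cnj \<alpha> * \<alpha> = 1" using h(2) by simp
  hence "complex_of_real ((cmod \<alpha>)\<^sup>2) = 1" by (simp only: complex_norm_square mult.commute)
  hence "(cmod \<alpha>)\<^sup>2 = 1" using of_real_eq_1_iff by blast
  hence "cmod \<alpha> = 1" by (simp add: abs_square_eq_1)
  show ?thesis
  proof (rule that[OF lm(1-3) \<open>cmod \<alpha> = 1\<close> Fl])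
    show "(fdiff ^^ m) (\<lambda>k. \<alpha> ^ k * g k) = (\<lambda>_. 0)" if "g \<in> G" for g
      using lm(5)[OF imageI[OF that, where f = "\<lambda>g k. \<alpha> ^ k * g k", folded G'_def]] .
  qed
qed

section \<open>Invertibility from a homogeneous relation\<close>

lemma bop_zero: "app_bop T 0 = 0"
  by (rule clinear_zero[OF bop_clinear])

lemma bop_diff: "app_bop T (x - y) = app_bop T x - app_bop T y"
  by (rule clinear_diff[OF bop_clinear])

lemma app_bop_add: "app_bop (S + T) x = app_bop S x + app_bop T x"
  by (simp add: plus_bop.rep_eq)

lemma app_bop_minus: "app_bop (S - T) x = app_bop S x - app_bop T x"
  using app_bop_add[of "S - T" T x] by simp

lemma app_bop_one [simp]: "app_bop 1 x = x"
  by (simp add: one_bop.rep_eq)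

lemma app_bop_zero [simp]: "app_bop 0 x = 0"
  by (simp add: zero_bop.rep_eq)

lemma app_bop_sum: "app_bop (\<Sum>i\<in>A. S i) x = (\<Sum>i\<in>A. app_bop (S i) x)"
  by (induction A rule: infinite_finite_induct) (simp_all add: app_bop_add)

lemma bop_bounded:
  obtains K where "K \<ge> 0" "\<And>x. norm (app_bop T x) \<le> K * norm x"
  using bounded_clinear_nonneg[OF bop_bounded_clinear] by (metis mult.commute)

text \<open>To solve \<open>D x + E x = y\<close>, iterate the contraction \<open>x \<mapsto> inv D (y - E x)\<close>.\<close>

lemma surj_add_small:
  fixes D E :: "'a::chilbert_space bop"
  assumes D: "surj (app_bop D)" "\<And>x. c * norm x \<le> norm (app_bop D x)"
    and E: "\<And>x. norm (app_bop E x) \<le> e * norm x" "0 \<le> e" "e < c"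
  shows "surj (app_bop (D + E))"
proof -
  have "\<exists>x. app_bop (D + E) x = y" for y
  proof -
    define h where "h x = inv (app_bop D) (y - app_bop E x)" for x
    have Dh: "app_bop D (h x) = y - app_bop E x" for x
      by (simp add: h_def surj_f_inv_f[OF D(1)])
    have "\<exists>!x\<in>UNIV. h x = x"
    proof (rule Banach_fix)
      show "dist (h x) (h x') \<le> (e / c) * dist x x'" for x x'
      proof -
        have "c * norm (h x - h x') \<le> norm (app_bop D (h x - h x'))" by (rule D(2))
        also have "app_bop D (h x - h x') = app_bop E (x' - x)" by (simp add: bop_diff Dh)
        also have "norm \<dots> \<le> e * norm (x' - x)" by (rule E(1))
        finally show "dist (h x) (h x') \<le> (e / c) * dist x x'"
          using E(2,3) by (simp add: dist_norm norm_minus_commute field_simps)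
      qed
    qed (use E(2,3) in \<open>auto simp: complete_UNIV\<close>)
    then obtain x where "h x = x" by blast
    hence "app_bop (D + E) x = y" using Dh[of x] by (simp add: app_bop_add)
    thus ?thesis by blast
  qed
  thus ?thesis by (metis surj_def)
qed

text \<open>Surjectivity of \<open>T - t \<omega>\<close> is locally constant in \<open>t \<ge> 0\<close>, because each of these operators is
  bounded below, and it holds for \<open>t\<close> larger than the norm of \<open>T\<close>; connectedness brings it down to \<open>t = 0\<close>.\<close>

lemma surj_if_bounded_below_on_ray:
  fixes T :: "'a::chilbert_space bop"
  assumes "cmod \<omega> = 1"
    and below: "\<And>t. t \<ge> 0 \<Longrightarrow> \<exists>c>0. \<forall>x. c * norm x \<le> norm (app_bop T x - (of_real t * \<omega>) *\<^sub>C x)"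
  shows "surj (app_bop T)"
proof -
  define S where "S t = T + (- (of_real t * \<omega>)) *\<^sub>C 1" for t
  have S: "app_bop (S t) x = app_bop T x - (of_real t * \<omega>) *\<^sub>C x" for t x
    by (simp add: S_def app_bop_add app_bop_minus app_bop_scaleC)
  have move: "S s = S t + (of_real (t - s) * \<omega>) *\<^sub>C 1" for s t
    by (rule bop_eqI) (simp add: S app_bop_add app_bop_minus app_bop_scaleC left_diff_distrib
        complex_vector.scale_left_diff_distrib)
  have small: "norm (app_bop ((of_real r * \<omega>) *\<^sub>C 1) x) \<le> \<bar>r\<bar> * norm x" for r and x :: 'a
    using assms(1) by (simp add: app_bop_scaleC norm_scaleC norm_mult)
  obtain K where K: "K \<ge> 0" "\<And>x. norm (app_bop T x) \<le> K * norm x" using bop_bounded[of T] by blast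
  have "surj (app_bop (S 0)) = surj (app_bop (S (K + 1)))"
  proof (rule connected_local_const[where A = "{0..}"])
    show "\<forall>t\<in>{0..}. eventually (\<lambda>s. surj (app_bop (S t)) = surj (app_bop (S s))) (at t within {0..})"
    proof
      fix t :: real assume "t \<in> {0..}"
      then obtain c where c: "c > 0" "\<And>x. c * norm x \<le> norm (app_bop (S t) x)"
        using below[of t] by (auto simp: S)
      have "surj (app_bop (S t)) = surj (app_bop (S s))" if "dist s t < c / 2" for s
      proof -
        have s: "\<bar>t - s\<bar> < c / 2" "\<bar>s - t\<bar> < c / 2"
          using that by (simp_all add: dist_real_def abs_minus_commute)
        show ?thesis
        proof
          assume "surj (app_bop (S t))"
          thus "surj (app_bop (S s))" unfolding move[of s t]
            by (rule surj_add_small[OF _ c(2) small]) (use s c(1) in auto)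
        next
          have low: "c / 2 * norm x \<le> norm (app_bop (S s) x)" for x
          proof -
            have "norm (app_bop (S t) x) - \<bar>t - s\<bar> * norm x \<le> norm (app_bop (S s) x)"
              unfolding move[of s t] app_bop_add using small[of "t - s" x]
                norm_diff_ineq[of "app_bop (S t) x" "app_bop ((of_real (t - s) * \<omega>) *\<^sub>C 1) x"] by linarith
            moreover have "\<bar>t - s\<bar> * norm x \<le> c / 2 * norm x"
              using s by (intro mult_right_mono) auto
            ultimately show ?thesis using c(2)[of x] by (simp add: field_simps)
          qed
          assume "surj (app_bop (S s))"
          thus "surj (app_bop (S t))" unfolding move[of t s]
            by (rule surj_add_small[OF _ low small]) (use s in auto)
        qed
      qed
      thus "eventually (\<lambda>s. surj (app_bop (S t)) = surj (app_bop (S s))) (at t within {0..})"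
        using c(1) unfolding eventually_at by (intro exI[of _ "c / 2"]) auto
    qed
  qed (use K in auto)
  moreover have "surj (app_bop (S (K + 1)))"
  proof -
    define z where "z = - (of_real (K + 1) * \<omega>)"
    have z: "cmod z = K + 1" using K(1) assms(1) by (simp add: z_def norm_mult del: of_real_add)
    have "z \<noteq> 0" using z K(1) by auto
    have "surj (app_bop (z *\<^sub>C 1 + T))"
    proof (rule surj_add_small[OF _ _ K(2) K(1)])
      show "surj (app_bop (z *\<^sub>C (1 :: 'a bop)))"
        by (rule surjI[of _ "\<lambda>x. inverse z *\<^sub>C x"]) (use \<open>z \<noteq> 0\<close> in \<open>simp add: app_bop_scaleC\<close>)
    qed (use z in \<open>auto simp: app_bop_scaleC norm_scaleC\<close>)
    thus ?thesis by (simp add: S_def z_def add.commute)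
  qed
  moreover have "S 0 = T" by (rule bop_eqI) (simp add: S)
  ultimately show ?thesis by simp
qed

lemma bop_inverse_exists:
  fixes T :: "'a::complex_inner bop"
  assumes "surj (app_bop T)" "c > 0" and below: "\<And>x. c * norm x \<le> norm (app_bop T x)"
  obtains R where "R * T = 1" "T * R = 1"
proof -
  define G where "G = inv (app_bop T)"
  have TG: "app_bop T (G y) = y" for y by (simp add: G_def surj_f_inv_f[OF assms(1)])
  have inj: "x = x'" if "app_bop T x = app_bop T x'" for x x'
  proof -
    have "c * norm (x - x') \<le> 0" using below[of "x - x'"] that by (simp add: bop_diff)
    thus ?thesis using assms(2) by (simp add: mult_le_0_iff)
  qed
  have "bounded_clinear G"
  proof (rule bounded_clinearI[where K = "1 / c"])
    show "G (x + y) = G x + G y" for x y by (rule inj) (simp add: TG bop_add)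
    show "G (d *\<^sub>C x) = d *\<^sub>C G x" for d x by (rule inj) (simp add: TG bop_scaleC)
    show "norm (G x) \<le> norm x * (1 / c)" for x
      using below[of "G x"] assms(2) by (simp add: TG field_simps)
  qed
  hence "app_bop (Abs_bop G) = G" by (simp add: Abs_bop_inverse)
  hence app: "app_bop (Abs_bop G * T) x = G (app_bop T x)" "app_bop (T * Abs_bop G) x = x" for x
    by (simp_all add: app_bop_times TG)
  have "Abs_bop G * T = 1" by (rule bop_eqI, rule inj) (simp add: app TG)
  moreover have "T * Abs_bop G = 1" by (rule bop_eqI) (simp add: app)
  ultimately show ?thesis by (rule that)
qed

lemma power_mod_linear_factor:
  fixes T :: "'a::complex_inner bop"
  shows "\<exists>C. \<forall>x. app_bop (T ^ j) x = z ^ j *\<^sub>C x + app_bop C (app_bop T x - z *\<^sub>C x)"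
proof (induction j)
  case 0
  show ?case by (rule exI[of _ 0]) simp
next
  case (Suc j)
  then obtain C where C: "app_bop (T ^ j) x = z ^ j *\<^sub>C x + app_bop C (app_bop T x - z *\<^sub>C x)" for x
    by blast
  have "app_bop (T ^ Suc j) x = z ^ Suc j *\<^sub>C x
      + app_bop (z ^ j *\<^sub>C 1 + T * C) (app_bop T x - z *\<^sub>C x)" for x
    by (simp add: app_bop_times C bop_add bop_scaleC app_bop_add app_bop_minus app_bop_scaleC
        complex_vector.scale_right_diff_distrib mult.commute)
  thus ?case by blast
qed

text \<open>On a vector \<open>x\<close> with \<open>T x \<approx> z x\<close> each \<open>T\<^sup>i\<close> acts approximately as \<open>z\<^sup>i\<close>, with an error linear in \<open>T x - z x\<close>.\<close>

lemma cinner_powers_near_eigenvector: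
  fixes T :: "'a::complex_inner bop"
  obtains M where "M \<ge> 0"
    "\<And>x. cmod (cinner (app_bop (T ^ i) x) (app_bop (T ^ j) x) - z ^ i * cnj z ^ j * of_real ((norm x)\<^sup>2))
      \<le> M * (norm x * norm (app_bop T x - z *\<^sub>C x))"
proof -
  obtain C where C: "\<And>x. app_bop (T ^ i) x = z ^ i *\<^sub>C x + app_bop C (app_bop T x - z *\<^sub>C x)"
    using power_mod_linear_factor by blast
  obtain B where B: "\<And>x. app_bop (T ^ j) x = z ^ j *\<^sub>C x + app_bop B (app_bop T x - z *\<^sub>C x)"
    using power_mod_linear_factor by blast
  obtain K where K: "K \<ge> 0" "\<And>x. norm (app_bop C x) \<le> K * norm x" using bop_bounded[of C] by blast
  obtain L where L: "L \<ge> 0" "\<And>x. norm (app_bop B x) \<le> L * norm x" using bop_bounded[of B] by blast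
  obtain N where N: "N \<ge> 0" "\<And>x. norm (app_bop (T ^ j) x) \<le> N * norm x" using bop_bounded[of "T ^ j"] by blast
  define M where "M = K * N + cmod z ^ i * L"
  have "M \<ge> 0" using K(1) L(1) N(1) by (simp add: M_def)
  moreover have "cmod (cinner (app_bop (T ^ i) x) (app_bop (T ^ j) x) - z ^ i * cnj z ^ j * of_real ((norm x)\<^sup>2))
      \<le> M * (norm x * norm (app_bop T x - z *\<^sub>C x))" for x
  proof -
    define d where "d = app_bop T x - z *\<^sub>C x"
    have "cinner (app_bop (T ^ i) x) (app_bop (T ^ j) x) - z ^ i * cnj z ^ j * of_real ((norm x)\<^sup>2)
      = cinner (app_bop C d) (app_bop (T ^ j) x) + z ^ i * cinner x (app_bop B d)"
      unfolding C[of x] d_def[symmetric] cinner_add_left cinner_scaleC_left cinner_self[symmetric]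
      by (simp add: B[of x] d_def[symmetric] cinner_add_right cinner_scaleC_right algebra_simps)
    also have "cmod \<dots> \<le> norm (app_bop C d) * norm (app_bop (T ^ j) x)
        + cmod z ^ i * (norm x * norm (app_bop B d))"
      by (intro norm_triangle_mono cauchy_schwarz)
        (simp add: norm_mult norm_power cauchy_schwarz mult_left_mono)
    also have "\<dots> \<le> (K * norm d) * (N * norm x) + cmod z ^ i * (norm x * (L * norm d))"
      using K L N by (intro add_mono mult_mono mult_left_mono) auto
    also have "\<dots> = M * (norm x * norm d)" by (simp add: M_def algebra_simps)
    finally show ?thesis by (simp add: d_def)
  qed
  ultimately show ?thesis by (rule that)
qed

text \<open>An approximate eigenvector for \<open>z\<close> would make the relation hold approximately with \<open>T\<close> replaced by \<open>z\<close>.\<close>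

lemma homogeneous_relation_bounded_below:
  fixes T :: "'a::complex_inner bop"
  assumes rel: "\<And>x. (\<Sum>k\<le>n. c k * cinner (app_bop (T ^ (n - k)) x) (app_bop (T ^ k) x)) = 0"
    and nz: "(\<Sum>k\<le>n. c k * (z ^ (n - k) * cnj z ^ k)) \<noteq> 0"
  shows "\<exists>d>0. \<forall>x. d * norm x \<le> norm (app_bop T x - z *\<^sub>C x)"
proof -
  have "\<exists>M\<ge>0. \<forall>x. cmod (cinner (app_bop (T ^ (n - k)) x) (app_bop (T ^ k) x)
      - z ^ (n - k) * cnj z ^ k * of_real ((norm x)\<^sup>2)) \<le> M * (norm x * norm (app_bop T x - z *\<^sub>C x))" for k
    using cinner_powers_near_eigenvector[of T "n - k" k z] by metis
  then obtain M where M: "\<And>k. M k \<ge> 0"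
    "\<And>k x. cmod (cinner (app_bop (T ^ (n - k)) x) (app_bop (T ^ k) x)
      - z ^ (n - k) * cnj z ^ k * of_real ((norm x)\<^sup>2)) \<le> M k * (norm x * norm (app_bop T x - z *\<^sub>C x))"
    by metis
  define p where "p = (\<Sum>k\<le>n. c k * (z ^ (n - k) * cnj z ^ k))"
  define N where "N = (\<Sum>k\<le>n. cmod (c k) * M k)"
  have N: "N \<ge> 0" using M(1) by (simp add: N_def sum_nonneg)
  have main: "cmod p * norm x \<le> N * norm (app_bop T x - z *\<^sub>C x)" for x
  proof (cases "x = 0")
    case False
    have "(\<Sum>k\<le>n. c k * (cinner (app_bop (T ^ (n - k)) x) (app_bop (T ^ k) x)
        - z ^ (n - k) * cnj z ^ k * of_real ((norm x)\<^sup>2))) = - (p * of_real ((norm x)\<^sup>2))"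
      unfolding right_diff_distrib sum_subtractf rel[of x] p_def sum_distrib_right
      by (simp add: mult.assoc)
    hence "cmod p * (norm x)\<^sup>2 = cmod (\<Sum>k\<le>n. c k * (cinner (app_bop (T ^ (n - k)) x) (app_bop (T ^ k) x)
      - z ^ (n - k) * cnj z ^ k * of_real ((norm x)\<^sup>2)))"
      by (simp only: norm_minus_cancel norm_mult norm_of_real abs_power2)
    also have "\<dots> \<le> (\<Sum>k\<le>n. cmod (c k) * (M k * (norm x * norm (app_bop T x - z *\<^sub>C x))))"
      by (intro sum_norm_le) (simp only: norm_mult, intro mult_left_mono M(2) norm_ge_zero)
    also have "\<dots> = N * norm (app_bop T x - z *\<^sub>C x) * norm x"
      unfolding N_def sum_distrib_right by (simp add: mult_ac)
    finally have "cmod p * norm x * norm x \<le> N * norm (app_bop T x - z *\<^sub>C x) * norm x"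
      by (simp add: power2_eq_square mult_ac)
    thus ?thesis using False by (simp add: mult_le_cancel_right)
  qed (simp add: bop_zero)
  have "cmod p > 0" using nz by (simp add: p_def)
  show ?thesis
  proof (intro exI[of _ "cmod p / (N + 1)"] conjI allI)
    fix x
    have "cmod p * norm x \<le> (N + 1) * norm (app_bop T x - z *\<^sub>C x)"
      using add_increasing2[OF norm_ge_zero main[of x]] by (simp add: distrib_right)
    thus "cmod p / (N + 1) * norm x \<le> norm (app_bop T x - z *\<^sub>C x)"
      using N by (simp add: field_simps)
  qed (use \<open>cmod p > 0\<close> N in auto)
qed

text \<open>For \<open>\<bar>\<omega>\<bar> = 1\<close> the sum equals \<open>\<omega>\<^sup>n p(z)\<close> where \<open>z = (cnj \<omega>)\<^sup>2\<close> and \<open>p\<close> is the polynomial with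
  coefficients \<open>c\<close>, and \<open>z\<close> ranges over the whole unit circle.\<close>

lemma unit_nonroot:
  fixes c :: "nat \<Rightarrow> complex"
  assumes "k\<^sub>0 \<le> n" "c k\<^sub>0 \<noteq> 0"
  obtains \<omega> where "cmod \<omega> = 1" "(\<Sum>k\<le>n. c k * (\<omega> ^ (n - k) * cnj \<omega> ^ k)) \<noteq> 0"
proof -
  define p where "p = (\<Sum>k\<le>n. monom (c k) k)"
  have "coeff p k\<^sub>0 = c k\<^sub>0" using assms(1) by (simp add: p_def coeff_sum)
  hence "p \<noteq> 0" using assms(2) by auto
  hence "finite {z. poly p z = 0}" by (rule poly_roots_finite)
  moreover have "infinite (sphere (0 :: complex) 1)"
  proof
    assume fin: "finite (sphere (0 :: complex) 1)"
    have "connected (sphere (0 :: complex) 1)" by (rule connected_sphere) simp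
    with fin have "sphere (0 :: complex) 1 = {} \<or> (\<exists>a. sphere (0 :: complex) 1 = {a})"
      by (simp only: connected_finite_iff_sing)
    moreover have "1 \<in> sphere (0 :: complex) 1" "-1 \<in> sphere (0 :: complex) 1" by simp_all
    ultimately have "1 = (-1 :: complex)" by (metis empty_iff singletonD)
    thus False by simp
  qed
  ultimately obtain z where z: "cmod z = 1" "poly p z \<noteq> 0"
    by (metis (mono_tags, lifting) finite_subset mem_Collect_eq mem_sphere_0 subsetI)
  define \<omega> where "\<omega> = cnj (csqrt z)"
  have "(cmod (csqrt z))\<^sup>2 = 1" using z(1) by (metis norm_power power2_csqrt)
  hence \<omega>: "cmod \<omega> = 1" by (simp add: \<omega>_def abs_square_eq_1)
  have "\<omega> * cnj \<omega> = 1" using \<omega> complex_norm_square[of \<omega>] by simp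
  moreover have "cnj \<omega> ^ 2 = z" by (simp add: \<omega>_def)
  ultimately have "\<omega> ^ (n - k) * cnj \<omega> ^ k = \<omega> ^ n * z ^ k" if "k \<le> n" for k
  proof -
    assume *: "\<omega> * cnj \<omega> = 1" "cnj \<omega> ^ 2 = z"
    have "\<omega> ^ n = \<omega> ^ (n - k) * \<omega> ^ k" using that by (simp add: power_add[symmetric])
    moreover have "z ^ k = cnj \<omega> ^ k * cnj \<omega> ^ k"
      by (simp only: *(2)[symmetric] power2_eq_square power_mult_distrib)
    ultimately have "\<omega> ^ n * z ^ k = \<omega> ^ (n - k) * cnj \<omega> ^ k * (\<omega> * cnj \<omega>) ^ k"
      by (simp only: power_mult_distrib mult_ac)
    thus ?thesis using * by simp
  qed
  hence "(\<Sum>k\<le>n. c k * (\<omega> ^ (n - k) * cnj \<omega> ^ k)) = \<omega> ^ n * poly p z"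
    by (simp add: p_def poly_sum poly_monom sum_distrib_left mult_ac)
  moreover have "\<omega> \<noteq> 0" using \<omega> by auto
  ultimately show ?thesis using that[OF \<omega>] z(2) by simp
qed

text \<open>A left invertible operator that satisfies a nontrivial homogeneous relation
  \<open>\<Sum>\<^sub>k c\<^sub>k (T\<^sup>\<star>)\<^sup>k T\<^bsup>n-k\<^esup> = 0\<close> is invertible. By homogeneity the relation excludes whole rays, not
  just single points, from the approximate point spectrum of \<open>T\<close>; left invertibility excludes the origin of
  such a ray, and the ray then leads from \<open>0\<close> into the resolvent set.\<close>

lemma left_invertible_homogeneous_relation:
  fixes T :: "'a::chilbert_space bop"
  assumes "left_invertible T" and k: "k\<^sub>0 \<le> n" "c k\<^sub>0 \<noteq> 0"
    and rel: "\<And>x. (\<Sum>k\<le>n. c k * cinner (app_bop (T ^ (n - k)) x) (app_bop (T ^ k) x)) = 0"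
  obtains R where "R * T = 1" "T * R = 1"
proof -
  obtain L where L: "L * T = 1" using assms(1) by (auto simp: left_invertible_def)
  obtain K where K: "K \<ge> 0" "\<And>x. norm (app_bop L x) \<le> K * norm x" using bop_bounded[of L] by blast
  have below: "inverse (K + 1) * norm x \<le> norm (app_bop T x)" for x
  proof -
    have "norm x = norm (app_bop L (app_bop T x))" using L by (metis app_bop_times app_bop_one)
    also have "\<dots> \<le> K * norm (app_bop T x)" by (rule K(2))
    also have "\<dots> \<le> (K + 1) * norm (app_bop T x)" by (simp add: mult_right_mono)
    finally show ?thesis using K(1) by (simp add: field_simps)
  qed
  obtain \<omega> where \<omega>: "cmod \<omega> = 1" "(\<Sum>k\<le>n. c k * (\<omega> ^ (n - k) * cnj \<omega> ^ k)) \<noteq> 0"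
    using unit_nonroot[of k\<^sub>0 n c, OF k] by blast
  have "surj (app_bop T)"
  proof (rule surj_if_bounded_below_on_ray[OF \<omega>(1)])
    fix t :: real assume "t \<ge> 0"
    show "\<exists>d>0. \<forall>x. d * norm x \<le> norm (app_bop T x - (of_real t * \<omega>) *\<^sub>C x)"
    proof (cases "t = 0")
      case True
      thus ?thesis using below K(1) by (intro exI[of _ "inverse (K + 1)"]) auto
    next
      case False
      have "(\<Sum>k\<le>n. c k * ((of_real t * \<omega>) ^ (n - k) * cnj (of_real t * \<omega>) ^ k))
        = of_real t ^ n * (\<Sum>k\<le>n. c k * (\<omega> ^ (n - k) * cnj \<omega> ^ k))"
        unfolding sum_distrib_left
      proof (intro sum.cong refl)
        fix k assume "k \<in> {..n}"
        hence "complex_of_real t ^ n = of_real t ^ (n - k) * of_real t ^ k"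
          by (simp add: power_add[symmetric])
        thus "c k * ((of_real t * \<omega>) ^ (n - k) * cnj (of_real t * \<omega>) ^ k)
            = of_real t ^ n * (c k * (\<omega> ^ (n - k) * cnj \<omega> ^ k))"
          by (simp add: power_mult_distrib)
      qed
      thus ?thesis using \<omega>(2) False by (intro homogeneous_relation_bounded_below[OF rel]) auto
    qed
  qed
  thus ?thesis using bop_inverse_exists[OF _ _ below] that K(1) by auto
qed

section \<open>Symmetries as difference equations for orbit coefficients\<close>

text \<open>With \<open>R\<close> the inverse of \<open>T\<close>, these are the matrix coefficients of \<open>(T\<^sup>\<star>)\<^sup>k R\<^sup>k\<close>.\<close>

definition orbit_coeff :: "'a::chilbert_space bop \<Rightarrow> 'a bop \<Rightarrow> 'a \<Rightarrow> 'a \<Rightarrow> nat \<Rightarrow> complex"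
  where "orbit_coeff R T x y = (\<lambda>k. cinner (app_bop (R ^ k) x) (app_bop (T ^ k) y))"

lemma orbit_coeff_Suc:
  "(\<lambda>k. orbit_coeff R T x y (Suc k)) = orbit_coeff R T (app_bop R x) (app_bop T y)"
  by (simp add: orbit_coeff_def power_Suc2 app_bop_times del: power_Suc)

lemma orbit_coeff_shift:
  "orbit_coeff R T x y (k + i) = orbit_coeff R T (app_bop (R ^ i) x) (app_bop (T ^ i) y) k"
  by (simp add: orbit_coeff_def power_add app_bop_times)

lemma app_power_inverse:
  assumes "A * B = (1 :: 'a::complex_inner bop)"
  shows "app_bop (A ^ k) (app_bop (B ^ k) x) = x"
proof (induction k arbitrary: x)
  case (Suc k)
  have "app_bop A (app_bop B y) = y" for y using assms by (metis app_bop_times app_bop_one)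
  moreover have "app_bop (A ^ Suc k) (app_bop (B ^ Suc k) x)
      = app_bop (A ^ k) (app_bop A (app_bop B (app_bop (B ^ k) x)))"
    by (simp add: power_Suc2[of A] app_bop_times del: power_Suc) (simp add: app_bop_times)
  ultimately show ?case using Suc by simp
qed simp

lemma app_power_diff:
  assumes "T * R = (1 :: 'a::complex_inner bop)" "k \<le> n"
  shows "app_bop (T ^ (n - k)) (app_bop (R ^ n) x) = app_bop (R ^ k) x"
proof -
  have "R ^ n = R ^ (n - k) * R ^ k" using assms(2) by (simp add: power_add[symmetric])
  thus ?thesis by (simp add: app_bop_times app_power_inverse[OF assms(1)])
qed

lemma cinner_adjoint_power: "cinner (app_bop ((T\<^sup>\<star>) ^ k) x) y = cinner x (app_bop (T ^ k) y)"
proof (induction k arbitrary: y)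
  case (Suc k)
  have "cinner (app_bop (T\<^sup>\<star>) u) y = cinner u (app_bop T y)" for u
    by (metis cinner_adjoint cinner_commute)
  thus ?case by (simp add: app_bop_times Suc power_Suc2[of T] del: power_Suc)
    (simp add: app_bop_times Suc)
qed simp

lemma cinner_gamma_adjoint:
  "cinner (app_bop (gamma n (T\<^sup>\<star>) T) x) y
    = (\<Sum>k\<le>n. of_nat (n choose k) * ((-1) ^ (n - k) * cinner (app_bop (T ^ (n - k)) x) (app_bop (T ^ k) y)))"
  by (simp add: gamma_def app_bop_sum app_bop_scaleC app_bop_times cinner_sum_left
      cinner_scaleC_left cinner_adjoint_power atLeast0AtMost mult_ac)

lemma n_symmetry_iff:
  "n_symmetry n T \<longleftrightarrow> (\<forall>x y. (\<Sum>k\<le>n. of_nat (n choose k) *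
    ((-1) ^ (n - k) * cinner (app_bop (T ^ (n - k)) x) (app_bop (T ^ k) y))) = 0)"
  unfolding n_symmetry_def cinner_gamma_adjoint[symmetric]
proof
  assume *: "\<forall>x y. cinner (app_bop (gamma n (T\<^sup>\<star>) T) x) y = 0"
  show "gamma n (T\<^sup>\<star>) T = 0"
    by (rule bop_eqI, rule cinner_ext) (simp add: *)
qed simp

text \<open>The symmetry is itself a homogeneous relation, with coefficient \<open>(-1)\<^sup>n \<noteq> 0\<close> at \<open>k = 0\<close>.\<close>

lemma n_symmetry_imp_invertible:
  fixes T :: "'a::chilbert_space bop"
  assumes "left_invertible T" "n_symmetry n T"
  obtains R where "R * T = 1" "T * R = 1"
  using left_invertible_homogeneous_relation[OF assms(1), of 0 n "\<lambda>k. of_nat (n choose k) * (-1) ^ (n - k)"]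
    assms(2) unfolding n_symmetry_iff by (simp add: mult.assoc) blast

text \<open>Replacing \<open>x\<close> by \<open>R\<^sup>n x\<close> turns \<open>T\<^bsup>n-k\<^esup> x\<close> into \<open>R\<^sup>k x\<close>. Since shifting an orbit coefficient only
  changes the two vectors, vanishing of the difference at \<open>0\<close> is the same as vanishing everywhere.\<close>

lemma n_symmetry_iff_fdiff:
  assumes "R * T = 1" "T * R = 1"
  shows "n_symmetry n T \<longleftrightarrow> (\<forall>x y. (fdiff ^^ n) (orbit_coeff R T x y) = (\<lambda>_. 0))"
proof -
  have eq: "(\<Sum>k\<le>n. of_nat (n choose k) * ((-1) ^ (n - k)
      * cinner (app_bop (T ^ (n - k)) (app_bop (R ^ n) x)) (app_bop (T ^ k) y)))
    = (fdiff ^^ n) (orbit_coeff R T x y) 0" for x y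
    unfolding fdiff_power orbit_coeff_def
    by (intro sum.cong refl) (simp add: app_power_diff[OF assms(2)])
  show ?thesis
  proof (intro iffI allI ext)
    fix x y k
    assume "n_symmetry n T"
    hence "(fdiff ^^ n) (orbit_coeff R T (app_bop (R ^ k) x) (app_bop (T ^ k) y)) 0 = 0"
      unfolding eq[symmetric] n_symmetry_iff by blast
    thus "(fdiff ^^ n) (orbit_coeff R T x y) k = 0"
      by (simp add: fdiff_power orbit_coeff_shift[symmetric] add.commute)
  next
    assume *: "\<forall>x y. (fdiff ^^ n) (orbit_coeff R T x y) = (\<lambda>_. 0)"
    show "n_symmetry n T"
      unfolding n_symmetry_iff
    proof (intro allI)
      fix x y
      show "(\<Sum>k\<le>n. of_nat (n choose k) * ((-1) ^ (n - k)
          * cinner (app_bop (T ^ (n - k)) x) (app_bop (T ^ k) y))) = 0"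
        using eq[of "app_bop (T ^ n) x" y] * by (simp add: app_power_inverse[OF assms(1)])
    qed
  qed
qed

lemma power_scaleC_bop: "(c *\<^sub>C T) ^ k = c ^ k *\<^sub>C (T ^ k :: 'a::complex_inner bop)"
  by (induction k) (simp_all add: mult_scaleC_left mult_scaleC_right mult.commute)

lemma orbit_coeff_scaleC:
  "orbit_coeff (c *\<^sub>C R) (d *\<^sub>C T) x y = (\<lambda>k. (c * cnj d) ^ k * orbit_coeff R T x y k)"
  by (simp add: orbit_coeff_def power_scaleC_bop app_bop_scaleC cinner_scaleC_left
      cinner_scaleC_right power_mult_distrib mult_ac)

lemma n_symmetry_scaleC_iff_fdiff:
  assumes "R * T = 1" "T * R = 1" "cmod \<mu> = 1"
  shows "n_symmetry n (\<mu> *\<^sub>C T)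
    \<longleftrightarrow> (\<forall>x y. (fdiff ^^ n) (\<lambda>k. (cnj \<mu> ^ 2) ^ k * orbit_coeff R T x y k) = (\<lambda>_. 0))"
proof -
  have \<mu>: "\<mu> * cnj \<mu> = 1" using complex_norm_square[of \<mu>] assms(3) by simp
  have "cnj \<mu> *\<^sub>C R * \<mu> *\<^sub>C T = 1" "\<mu> *\<^sub>C T * cnj \<mu> *\<^sub>C R = 1"
    using assms \<mu> by (simp_all add: mult_scaleC_left mult_scaleC_right mult.commute)
  thus ?thesis by (simp add: n_symmetry_iff_fdiff orbit_coeff_scaleC power2_eq_square)
qed

section \<open>Symmetries of tensor products\<close>

lemma htensor_separates:
  assumes "\<And>x y. cinner z (htensor x y) = 0"
  shows "z = 0"
proof -
  have "continuous_on UNIV (cinner z)"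
    by (intro linear_continuous_on bounded_bilinear.bounded_linear_right[OF bounded_bilinear_cinner])
  hence "closed {w. cinner z w = 0}" by (intro closed_Collect_eq) auto
  moreover have "complex_vector.span (range (case_prod htensor)) \<subseteq> {w. cinner z w = 0}"
  proof
    fix w assume "w \<in> complex_vector.span (range (case_prod (htensor :: 'a \<Rightarrow> 'b \<Rightarrow> _)))"
    thus "w \<in> {w. cinner z w = 0}"
    proof (induction rule: complex_vector.span_induct_alt)
      case (step c x y)
      thus ?case using assms by (auto simp: cinner_add_right cinner_scaleC_right)
    qed simp
  qed
  ultimately have "UNIV \<subseteq> {w. cinner z w = 0}"
    unfolding htensor_total[symmetric] by (rule closure_minimal[rotated])
  hence "cinner z z = 0" by blast
  thus ?thesis by simp
qed

text \<open>Both \<open>A\<close> and \<open>0\<close> have the property that characterizes \<open>0 \<otimes>\<^sub>o 0\<close>.\<close>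

lemma bop_eq_0_if_zero_on_htensor:
  fixes A :: "('a::complex_inner, 'b::complex_inner) htensor bop"
  assumes "\<And>x y. app_bop A (htensor x y) = 0"
  shows "A = 0"
proof -
  have "htensor 0 0 = (0 :: ('a, 'b) htensor)"
    using cinner_htensor[of "0 :: 'a" "0 :: 'b" 0 0] by (simp only: cinner_zero_left mult_zero_left cinner_self_eq_0)
  hence null: "\<forall>x y. app_bop B (htensor x y) = htensor (app_bop (0 :: 'a bop) x) (app_bop (0 :: 'b bop) y)"
    if "\<And>x y. app_bop B (htensor x y) = 0" for B using that by simp
  have "B = 0 \<otimes>\<^sub>o 0" if "\<And>x y. app_bop B (htensor x y) = 0" for B :: "('a, 'b) htensor bop"
    unfolding tensor_bop_def by (rule the1_equality[OF tensor_bop_ex1 null[OF that], symmetric])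
  from this[of A] this[of 0] show ?thesis using assms by simp
qed

lemma app_tensor_bop_power:
  "app_bop ((S \<otimes>\<^sub>o T) ^ k) (htensor x y) = htensor (app_bop (S ^ k) x) (app_bop (T ^ k) y)"
  by (induction k) (simp_all add: app_bop_times app_tensor_bop)

text \<open>Pure tensors are total, and on them the powers of \<open>S \<otimes>\<^sub>o T\<close> and the inner product both factor.\<close>

lemma n_symmetry_tensor_iff:
  "n_symmetry n (S \<otimes>\<^sub>o T) \<longleftrightarrow> (\<forall>x x' y y'. (\<Sum>k\<le>n. of_nat (n choose k) * ((-1) ^ (n - k)
    * (cinner (app_bop (S ^ (n - k)) x) (app_bop (S ^ k) x')
      * cinner (app_bop (T ^ (n - k)) y) (app_bop (T ^ k) y')))) = 0)"
  (is "?L \<longleftrightarrow> (\<forall>x x' y y'. ?s x x' y y' = 0)")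
proof -
  let ?G = "gamma n ((S \<otimes>\<^sub>o T)\<^sup>\<star>) (S \<otimes>\<^sub>o T)"
  have eq: "cinner (app_bop ?G (htensor x y)) (htensor x' y') = ?s x x' y y'" for x x' y y'
    unfolding cinner_gamma_adjoint app_tensor_bop_power cinner_htensor ..
  show ?thesis
  proof
    assume ?L
    thus "\<forall>x x' y y'. ?s x x' y y' = 0" unfolding eq[symmetric] n_symmetry_def by simp
  next
    assume "\<forall>x x' y y'. ?s x x' y y' = 0"
    hence "?G = 0"
      by (intro bop_eq_0_if_zero_on_htensor htensor_separates) (simp only: eq)
    thus ?L by (simp add: n_symmetry_def)
  qed
qed

lemma n_symmetry_tensor_iff_fdiff:
  assumes "R * S = 1" "S * R = 1" "Q * T = 1" "T * Q = 1"
  shows "n_symmetry n (S \<otimes>\<^sub>o T) \<longleftrightarrow>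
    (\<forall>x x' y y'. (fdiff ^^ n) (\<lambda>k. orbit_coeff R S x x' k * orbit_coeff Q T y y' k) 0 = 0)"
proof -
  have eq: "(\<Sum>k\<le>n. of_nat (n choose k) * ((-1) ^ (n - k)
      * (cinner (app_bop (S ^ (n - k)) (app_bop (R ^ n) x)) (app_bop (S ^ k) x')
        * cinner (app_bop (T ^ (n - k)) (app_bop (Q ^ n) y)) (app_bop (T ^ k) y'))))
    = (fdiff ^^ n) (\<lambda>k. orbit_coeff R S x x' k * orbit_coeff Q T y y' k) 0" for x x' y y'
    unfolding fdiff_power orbit_coeff_def
    by (intro sum.cong refl) (simp add: app_power_diff[OF assms(2)] app_power_diff[OF assms(4)])
  show ?thesis
    unfolding n_symmetry_tensor_iff
  proof (intro iffI allI)
    fix x x' y y'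
    assume *: "\<forall>x x' y y'. (fdiff ^^ n) (\<lambda>k. orbit_coeff R S x x' k * orbit_coeff Q T y y' k) 0 = 0"
    show "(\<Sum>k\<le>n. of_nat (n choose k) * ((-1) ^ (n - k)
      * (cinner (app_bop (S ^ (n - k)) x) (app_bop (S ^ k) x')
        * cinner (app_bop (T ^ (n - k)) y) (app_bop (T ^ k) y')))) = 0"
      using eq[of "app_bop (S ^ n) x" x' "app_bop (T ^ n) y" y']
      unfolding app_power_inverse[OF assms(1)] app_power_inverse[OF assms(3)] *[rule_format] .
  qed (simp only: eq[symmetric])
qed

lemma tensor_bop_scaleC: "(c *\<^sub>C S) \<otimes>\<^sub>o (d *\<^sub>C T) = (c * d) *\<^sub>C (S \<otimes>\<^sub>o T)"
proof -
  have "app_bop ((c * d) *\<^sub>C (S \<otimes>\<^sub>o T)) (htensor x y)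
      = htensor (app_bop (c *\<^sub>C S) x) (app_bop (d *\<^sub>C T) y)" for x y
    by (simp add: app_bop_scaleC app_tensor_bop cbilinear_simps[OF cbilinear_htensor])
  thus ?thesis using tensor_bop_ex1[of "c *\<^sub>C S" "d *\<^sub>C T"] app_tensor_bop by blast
qed

lemma left_invertible_scaleC:
  assumes "left_invertible T" "c \<noteq> 0"
  shows "left_invertible (c *\<^sub>C T)"
proof -
  obtain L where "L * T = 1" using assms(1) by (auto simp: left_invertible_def)
  hence "(inverse c *\<^sub>C L) * (c *\<^sub>C T) = 1"
    using assms(2) by (simp add: mult_scaleC_left mult_scaleC_right)
  thus ?thesis unfolding left_invertible_def by blast
qed

lemma n_symmetry_tensor:
  assumes "left_invertible S" "left_invertible T" "n_symmetry l S" "n_symmetry m T" "l + m \<le> n + 1"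
  shows "n_symmetry n (S \<otimes>\<^sub>o T)"
proof -
  obtain R where R: "R * S = 1" "S * R = 1" using n_symmetry_imp_invertible[OF assms(1,3)] by blast
  obtain Q where Q: "Q * T = 1" "T * Q = 1" using n_symmetry_imp_invertible[OF assms(2,4)] by blast
  have "(fdiff ^^ l) (orbit_coeff R S x x') = (\<lambda>_. 0)" for x x'
    using assms(3) n_symmetry_iff_fdiff[OF R] by blast
  moreover have "(fdiff ^^ m) (orbit_coeff Q T y y') = (\<lambda>_. 0)" for y y'
    using assms(4) n_symmetry_iff_fdiff[OF Q] by blast
  ultimately have "(fdiff ^^ n) (\<lambda>k. orbit_coeff R S x x' k * orbit_coeff Q T y y' k) = (\<lambda>_. 0)"
    for x x' y y' using assms(5) by (intro fdiff_power_mult_eq_0[of l _ m]) simp_all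
  thus ?thesis by (simp add: n_symmetry_tensor_iff_fdiff[OF R Q])
qed

lemma left_invertible_power_neq_0:
  assumes "left_invertible T" "x \<noteq> 0"
  shows "app_bop (T ^ n) x \<noteq> 0"
proof -
  obtain L where "L * T = 1" using assms(1) by (auto simp: left_invertible_def)
  hence "app_bop (L ^ n) (app_bop (T ^ n) x) = x" by (rule app_power_inverse)
  thus ?thesis using assms(2) by (metis bop_zero)
qed

text \<open>Freezing the vectors of the second factor gives a homogeneous relation for \<open>S\<close>. Its coefficient at
  \<open>k = 0\<close> is nonzero once the frozen vectors are \<open>y\<close> and \<open>T\<^sup>n y\<close>, as \<open>T\<^sup>n\<close> is injective. The relation is an
  explicit hypothesis so that the two factors can exchange roles.\<close>

lemma n_symmetry_tensor_imp_invertible: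
  fixes S :: "'a::chilbert_space bop" and T :: "'b::chilbert_space bop"
  assumes "left_invertible S" "left_invertible T"
    and rel: "\<And>x x' y y'. (\<Sum>k\<le>n. of_nat (n choose k) * ((-1) ^ (n - k)
      * (cinner (app_bop (S ^ (n - k)) x) (app_bop (S ^ k) x')
        * cinner (app_bop (T ^ (n - k)) y) (app_bop (T ^ k) y')))) = 0"
    and "\<exists>y::'b. y \<noteq> 0"
  obtains R where "R * S = 1" "S * R = 1"
proof -
  obtain y :: 'b where "y \<noteq> 0" using assms(4) by blast
  define c where "c k = of_nat (n choose k) * ((-1) ^ (n - k)
    * cinner (app_bop (T ^ (n - k)) y) (app_bop (T ^ k) (app_bop (T ^ n) y)))" for k
  have "c 0 \<noteq> 0"
    using left_invertible_power_neq_0[OF assms(2) \<open>y \<noteq> 0\<close>] by (simp add: c_def)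
  moreover have "(\<Sum>k\<le>n. c k * cinner (app_bop (S ^ (n - k)) x) (app_bop (S ^ k) x)) = 0" for x
    using rel[of x x y "app_bop (T ^ n) y"] by (simp add: c_def mult_ac)
  ultimately show ?thesis
    using left_invertible_homogeneous_relation[OF assms(1), of 0 n c] that by blast
qed

text \<open>The orbit coefficients of \<open>T1\<close> and of \<open>T2\<close> form two families to which the combinatorial core
  applies. The unimodular \<open>\<alpha>\<close> found there is the square of the required scalar, since the factor \<open>\<mu>\<close> occurs in
  an orbit coefficient of \<open>\<mu> *\<^sub>C T1\<close> once through the operator and once through its inverse.\<close>

lemma n_symmetry_tensor_split:
  fixes T1 :: "'a::chilbert_space bop" and T2 :: "'b::chilbert_space bop"
  assumes ne: "\<exists>x::'a. x \<noteq> 0" "\<exists>y::'b. y \<noteq> 0"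
    and li: "left_invertible T1" "left_invertible T2"
    and sym: "n_symmetry n (T1 \<otimes>\<^sub>o T2)"
  obtains l m \<mu> where "l \<ge> 1" "m \<ge> 1" "l + m = n + 1" "cmod \<mu> = 1"
    "n_symmetry l (\<mu> *\<^sub>C T1)" "n_symmetry m (cnj \<mu> *\<^sub>C T2)"
proof -
  note rel = sym[unfolded n_symmetry_tensor_iff, rule_format]
  obtain R where R: "R * T1 = 1" "T1 * R = 1"
    using n_symmetry_tensor_imp_invertible[OF li rel ne(2)] by blast
  obtain Q where Q: "Q * T2 = 1" "T2 * Q = 1"
  proof (rule n_symmetry_tensor_imp_invertible[OF li(2) li(1) _ ne(1)])
    show "(\<Sum>k\<le>n. of_nat (n choose k) * ((-1) ^ (n - k)
      * (cinner (app_bop (T2 ^ (n - k)) y) (app_bop (T2 ^ k) y')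
        * cinner (app_bop (T1 ^ (n - k)) x) (app_bop (T1 ^ k) x')))) = 0" for x x' y y'
      using rel[where x = x and x' = x' and y = y and y' = y'] by (simp only: mult.commute)
  qed
  define F where "F = range (\<lambda>(x, x'). orbit_coeff R T1 x x')"
  define G where "G = range (\<lambda>(y, y'). orbit_coeff Q T2 y y')"
  have F: "orbit_coeff R T1 x x' \<in> F" for x x' by (auto simp: F_def)
  have G: "orbit_coeff Q T2 y y' \<in> G" for y y' by (auto simp: G_def)
  obtain x\<^sub>0 :: 'a where x0: "x\<^sub>0 \<noteq> 0" using ne by blast
  obtain y\<^sub>0 :: 'b where y0: "y\<^sub>0 \<noteq> 0" using ne by blast
  obtain l m \<alpha> where lm: "l \<ge> 1" "m \<ge> 1" "l + m = n + 1" and \<alpha>: "cmod \<alpha> = 1"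
    and l: "\<And>f. f \<in> F \<Longrightarrow> (fdiff ^^ l) (\<lambda>k. inverse \<alpha> ^ k * f k) = (\<lambda>_. 0)"
    and m: "\<And>g. g \<in> G \<Longrightarrow> (fdiff ^^ m) (\<lambda>k. \<alpha> ^ k * g k) = (\<lambda>_. 0)"
  proof (rule null_family_split[of F G "orbit_coeff R T1 x\<^sub>0 x\<^sub>0" "orbit_coeff Q T2 y\<^sub>0 y\<^sub>0" n])
    show "(\<lambda>k. f (Suc k)) \<in> F" if mem: "f \<in> F" for f
    proof -
      obtain x x' where f: "f = orbit_coeff R T1 x x'" using mem by (auto simp: F_def)
      show ?thesis unfolding f orbit_coeff_Suc by (rule F)
    qed
    show "(\<lambda>k. g (Suc k)) \<in> G" if mem: "g \<in> G" for g
    proof -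
      obtain y y' where g: "g = orbit_coeff Q T2 y y'" using mem by (auto simp: G_def)
      show ?thesis unfolding g orbit_coeff_Suc by (rule G)
    qed
    \<comment> \<open>Starting from \<open>T1\<^sup>N x'\<close> and \<open>R\<^sup>N x\<close> and running forward runs the orbits of \<open>x'\<close> and \<open>x\<close> backward.\<close>
    show "\<exists>f'\<in>F. \<forall>k\<le>N. f' k = cnj (f (N - k))" if mem: "f \<in> F" for f N
    proof -
      obtain x x' where f: "f = orbit_coeff R T1 x x'" using mem by (auto simp: F_def)
      have "orbit_coeff R T1 (app_bop (T1 ^ N) x') (app_bop (R ^ N) x) k = cnj (f (N - k))"
        if "k \<le> N" for k
        using app_power_diff[OF R(1), of "N - k" N x'] app_power_diff[OF R(2), of "N - k" N x] that
        by (simp add: f orbit_coeff_def) (metis cinner_commute)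
      thus ?thesis using F by blast
    qed
    show "orbit_coeff Q T2 y\<^sub>0 y\<^sub>0 0 \<noteq> 0" using y0 by (simp add: orbit_coeff_def)
    show "orbit_coeff R T1 x\<^sub>0 x\<^sub>0 \<noteq> (\<lambda>_. 0)"
      using x0 by (auto simp: orbit_coeff_def dest!: fun_cong[where x = 0])
    show "(fdiff ^^ n) (\<lambda>k. f k * g k) 0 = 0" if "f \<in> F" "g \<in> G" for f g
      using that sym unfolding n_symmetry_tensor_iff_fdiff[OF R Q] by (auto simp: F_def G_def)
  qed (use F G in blast)+
  define \<mu> where "\<mu> = csqrt \<alpha>"
  have "\<mu> ^ 2 = \<alpha>" by (simp add: \<mu>_def)
  hence "(cmod \<mu>)\<^sup>2 = 1" using \<alpha> by (metis norm_power)
  hence \<mu>: "cmod \<mu> = 1" by (simp add: abs_square_eq_1)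
  have "\<alpha> * cnj \<alpha> = 1" using complex_norm_square[of \<alpha>] \<alpha> by simp
  hence inv: "cnj \<mu> ^ 2 = inverse \<alpha>"
    using \<open>\<mu> ^ 2 = \<alpha>\<close> by (metis complex_cnj_power inverse_unique)
  have "n_symmetry l (\<mu> *\<^sub>C T1)"
    using l[OF F] by (simp add: n_symmetry_scaleC_iff_fdiff[OF R \<mu>] inv)
  moreover have "n_symmetry m (cnj \<mu> *\<^sub>C T2)"
    using m[OF G] \<mu> \<open>\<mu> ^ 2 = \<alpha>\<close> by (subst n_symmetry_scaleC_iff_fdiff[OF Q]) simp_all
  ultimately show ?thesis using that[OF lm \<mu>] by blast
qed

theorem theorem1p2:
  fixes T1 :: "'a::chilbert_space bop" and T2 :: "'b::chilbert_space bop" and n :: nat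
  assumes "\<exists>x::'a. x \<noteq> 0" and "\<exists>y::'b. y \<noteq> 0"
    and "n \<ge> 1"
    and "left_invertible T1" and "left_invertible T2"
  shows "n_symmetry n (T1 \<otimes>\<^sub>o T2) \<longleftrightarrow>
    (\<exists>(l::nat) (m::nat) \<mu>::complex. l \<ge> 1 \<and> m \<ge> 1 \<and> l + m = n + 1 \<and> cmod \<mu> = 1 \<and>
      n_symmetry l (\<mu> *\<^sub>C T1) \<and> n_symmetry m (cnj \<mu> *\<^sub>C T2))"
proof
  assume "n_symmetry n (T1 \<otimes>\<^sub>o T2)"
  from n_symmetry_tensor_split[OF assms(1,2,4,5) this]
  show "\<exists>(l::nat) (m::nat) \<mu>::complex. l \<ge> 1 \<and> m \<ge> 1 \<and> l + m = n + 1 \<and> cmod \<mu> = 1 \<and>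
      n_symmetry l (\<mu> *\<^sub>C T1) \<and> n_symmetry m (cnj \<mu> *\<^sub>C T2)" by metis
next
  assume "\<exists>(l::nat) (m::nat) \<mu>::complex. l \<ge> 1 \<and> m \<ge> 1 \<and> l + m = n + 1 \<and> cmod \<mu> = 1 \<and>
      n_symmetry l (\<mu> *\<^sub>C T1) \<and> n_symmetry m (cnj \<mu> *\<^sub>C T2)"
  then obtain l m :: nat and \<mu> where lm: "l + m = n + 1" and \<mu>: "cmod \<mu> = 1"
    and sym: "n_symmetry l (\<mu> *\<^sub>C T1)" "n_symmetry m (cnj \<mu> *\<^sub>C T2)" by blast
  have "\<mu> \<noteq> 0" "\<mu> * cnj \<mu> = 1" using \<mu> complex_norm_square[of \<mu>] by auto
  have "n_symmetry n ((\<mu> *\<^sub>C T1) \<otimes>\<^sub>o (cnj \<mu> *\<^sub>C T2))"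
    using lm \<open>\<mu> \<noteq> 0\<close> by (intro n_symmetry_tensor[OF _ _ sym] left_invertible_scaleC assms(4,5)) auto
  thus "n_symmetry n (T1 \<otimes>\<^sub>o T2)"
    by (simp add: tensor_bop_scaleC \<open>\<mu> * cnj \<mu> = 1\<close>)
qed

end
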